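(* Let $I$ be an ideal of a Noetherian local ring $(R,\mathfrak{m})$ and let $\cdots\to F_2\xrightarrow{d_2}F_1\xrightarrow{d_1}F_0\to R/I\to0$ be a minimal free resolution of $R/I$ (with $F_0=R$). Set $s_n=\mathrm{AR}(\mathfrak{m},\operatorname{im}(d_{n+1})\subseteq F_n)$ for all $n\ge0$, and let $p$ and $N_0$ be natural numbers with $N_0>\max\{s_i: i=0,\ldots,p\}$. Let $N>N_0+\sum_{i=0}^{p-1}s_i$. Then for every ideal $J$ of $R$ such that $J+\mathfrak{m}^N=I+\mathfrak{m}^N$ and such that $R/I$ and $R/J$ have the same Hilbert function, there exist $R$-linear maps $\delta_i:F_i\to\mathfrak{m}^{N_0}F_{i-1}$, $i=1,\ldots,p+1$, such that $F_{p+1}\xrightarrow{d_{p+1}+\delta_{p+1}}F_p\xrightarrow{d_p+\delta_p}\cdots\xrightarrow{d_2+\delta_2}F_1\xrightarrow{d_1+\delta_1}F_0\to R/J\to0$ is exact; moreover, $(\operatorname{im} d_i)^*=(\operatorname{im}(d_i+\delta_i))^*$ for all $i=1,\ldots,p+1$, where both initial modules are computed inside $\mathrm{gr}_{\mathfrak{m}}(F_{i-1})$.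
   Context: $\mathrm{AR}(\mathfrak{m},L\subseteq M)$ is the least integer $s$ with $\mathfrak{m}^nM\cap L=\mathfrak{m}^{n-s}(\mathfrak{m}^sM\cap L)$ for all $n\ge s$. For a submodule $L$ of a finitely generated module $M$, the initial module $L^*\subseteq\mathrm{gr}_{\mathfrak{m}}(M)=\bigoplus_i\mathfrak{m}^iM/\mathfrak{m}^{i+1}M$ is $\bigoplus_{i\ge0}(L\cap\mathfrak{m}^iM+\mathfrak{m}^{i+1}M)/\mathfrak{m}^{i+1}M$. The Hilbert function of $R/I$ is $n\mapsto\dim_k\mathfrak{m}^n(R/I)/\mathfrak{m}^{n+1}(R/I)$, $k=R/\mathfrak{m}$. *)

theory Defs
  imports Main
begin

text \<open>The ring R is the whole of a type 'a of class comm_ring_1.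
  Finite free modules R^b are represented as functions nat => 'a vanishing from index b on;
  R-linear maps R^bi -> R^bo are represented by matrices nat => nat => 'a.\<close>

definition is_ideal :: "'a::comm_ring_1 set \<Rightarrow> bool" where
  "is_ideal I \<longleftrightarrow> 0 \<in> I \<and> (\<forall>x\<in>I. \<forall>y\<in>I. x + y \<in> I) \<and> (\<forall>r. \<forall>x\<in>I. r * x \<in> I)"

definition ideal_gen :: "'a::comm_ring_1 set \<Rightarrow> 'a set" where
  "ideal_gen S = \<Inter>{J. is_ideal J \<and> S \<subseteq> J}"

definition ideal_sum :: "'a::comm_ring_1 set \<Rightarrow> 'a set \<Rightarrow> 'a set" where
  "ideal_sum I J = {x + y | x y. x \<in> I \<and> y \<in> J}"

fun ideal_pow :: "'a::comm_ring_1 set \<Rightarrow> nat \<Rightarrow> 'a set" where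
  "ideal_pow m 0 = UNIV"
| "ideal_pow m (Suc n) = ideal_gen {a * b | a b. a \<in> m \<and> b \<in> ideal_pow m n}"

definition noetherian_ring :: "'a::comm_ring_1 itself \<Rightarrow> bool" where
  "noetherian_ring _ \<longleftrightarrow> (\<forall>J::'a set. is_ideal J \<longrightarrow> (\<exists>S. finite S \<and> J = ideal_gen S))"

definition local_ring :: "'a::comm_ring_1 set \<Rightarrow> bool" where
  "local_ring m \<longleftrightarrow> is_ideal m \<and> m \<noteq> UNIV \<and> (\<forall>J. is_ideal J \<and> J \<noteq> UNIV \<longrightarrow> J \<subseteq> m)"

definition fvec :: "nat \<Rightarrow> (nat \<Rightarrow> 'a::comm_ring_1) set" where
  "fvec b = {v. \<forall>j\<ge>b. v j = 0}"

definition is_submod :: "(nat \<Rightarrow> 'a::comm_ring_1) set \<Rightarrow> bool" where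
  "is_submod L \<longleftrightarrow> (\<lambda>_. 0) \<in> L \<and> (\<forall>x\<in>L. \<forall>y\<in>L. (\<lambda>j. x j + y j) \<in> L)
      \<and> (\<forall>r. \<forall>x\<in>L. (\<lambda>j. r * x j) \<in> L)"

definition submod_gen :: "(nat \<Rightarrow> 'a::comm_ring_1) set \<Rightarrow> (nat \<Rightarrow> 'a) set" where
  "submod_gen S = \<Inter>{L. is_submod L \<and> S \<subseteq> L}"

definition ideal_smult :: "'a::comm_ring_1 set \<Rightarrow> (nat \<Rightarrow> 'a) set \<Rightarrow> (nat \<Rightarrow> 'a) set" where
  "ideal_smult A L = submod_gen {(\<lambda>j. a * v j) | a v. a \<in> A \<and> v \<in> L}"

definition vsum :: "(nat \<Rightarrow> 'a::comm_ring_1) set \<Rightarrow> (nat \<Rightarrow> 'a) set \<Rightarrow> (nat \<Rightarrow> 'a) set" where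
  "vsum L K = {(\<lambda>j. x j + y j) | x y. x \<in> L \<and> y \<in> K}"

definition ideal_vec :: "'a::comm_ring_1 set \<Rightarrow> (nat \<Rightarrow> 'a) set" where
  "ideal_vec I = {v. v 0 \<in> I \<and> (\<forall>j\<ge>1. v j = 0)}"

definition mapply :: "(nat \<Rightarrow> nat \<Rightarrow> 'a::comm_ring_1) \<Rightarrow> nat \<Rightarrow> nat \<Rightarrow> (nat \<Rightarrow> 'a) \<Rightarrow> (nat \<Rightarrow> 'a)" where
  "mapply A bo bi v = (\<lambda>r. if r < bo then (\<Sum>c<bi. A r c * v c) else 0)"

definition mimage :: "(nat \<Rightarrow> nat \<Rightarrow> 'a::comm_ring_1) \<Rightarrow> nat \<Rightarrow> nat \<Rightarrow> (nat \<Rightarrow> 'a) set" where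
  "mimage A bo bi = mapply A bo bi ` fvec bi"

definition mkernel :: "(nat \<Rightarrow> nat \<Rightarrow> 'a::comm_ring_1) \<Rightarrow> nat \<Rightarrow> nat \<Rightarrow> (nat \<Rightarrow> 'a) set" where
  "mkernel A bo bi = {v \<in> fvec bi. mapply A bo bi v = (\<lambda>_. 0)}"

definition AR :: "'a::comm_ring_1 set \<Rightarrow> (nat \<Rightarrow> 'a) set \<Rightarrow> (nat \<Rightarrow> 'a) set \<Rightarrow> nat" where
  "AR m L M = (LEAST s. \<forall>n\<ge>s. ideal_smult (ideal_pow m n) M \<inter> L
       = ideal_smult (ideal_pow m (n - s)) (ideal_smult (ideal_pow m s) M \<inter> L))"

text \<open>Degree i piece of the initial module L^* in gr_m(M), represented by its preimage
  L \<inter> m^i M + m^(i+1) M in M (the piece is this set modulo m^(i+1) M).\<close>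
definition initial_piece :: "'a::comm_ring_1 set \<Rightarrow> (nat \<Rightarrow> 'a) set \<Rightarrow> (nat \<Rightarrow> 'a) set \<Rightarrow> nat \<Rightarrow> (nat \<Rightarrow> 'a) set" where
  "initial_piece m M L i = vsum (L \<inter> ideal_smult (ideal_pow m i) M) (ideal_smult (ideal_pow m (Suc i)) M)"

definition initial_module :: "'a::comm_ring_1 set \<Rightarrow> (nat \<Rightarrow> 'a) set \<Rightarrow> (nat \<Rightarrow> 'a) set \<Rightarrow> nat \<Rightarrow> (nat \<Rightarrow> 'a) set" where
  "initial_module m M L = (\<lambda>i. initial_piece m M L i)"

text \<open>Hilbert function of R/I: dim_k of m^n(R/I)/m^(n+1)(R/I) = (m^n+I)/(m^(n+1)+I),
  the dimension of this k-vector space being the least size of a spanning set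
  (k-span and R-span coincide since m annihilates it).\<close>
definition hilbert_fun :: "'a::comm_ring_1 set \<Rightarrow> 'a set \<Rightarrow> nat \<Rightarrow> nat" where
  "hilbert_fun m I n = (LEAST t. \<exists>S. finite S \<and> card S = t \<and> S \<subseteq> ideal_sum (ideal_pow m n) I \<and>
       ideal_sum (ideal_pow m n) I \<subseteq> ideal_sum (ideal_gen S) (ideal_sum (ideal_pow m (Suc n)) I))"

end

theory Submission
  imports Defs "HOL-Library.Function_Algebras"
begin

text \<open>Write \<open>L = im d\<close> and \<open>L' = im (d + \<delta>)\<close> in a finite free module \<open>F\<close>, with \<open>s = AR(m, L)\<close> and
  the entries of \<open>\<delta>\<close> in \<open>m\<^sup>M\<close>, \<open>M > s\<close>. By definition of \<open>s\<close>, every element of \<open>L \<inter> m\<^sup>nF\<close> is the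
  image of a vector with entries in \<open>m\<^sup>n\<^sup>-\<^sup>s\<close>. If \<open>L\<close> and \<open>L'\<close> have the same initial module, successive
  approximation gives the same statement for \<open>L'\<close> with the same \<open>s\<close>. Hence the syzygies of \<open>d\<close>, which
  \<open>d + \<delta>\<close> maps into \<open>m\<^sup>M F\<close>, can be corrected by vectors with entries in \<open>m\<^sup>M\<^sup>-\<^sup>s\<close> to syzygies of
  \<open>d + \<delta>\<close>: this is the next \<open>\<delta>\<close>. The corrected syzygies generate a submodule of \<open>ker (d + \<delta>)\<close> whose
  initial module is squeezed between those of \<open>ker d\<close> and \<open>ker (d + \<delta>)\<close>, and the latter is contained in
  the former; so all three agree, and Nakayama's lemma yields exactness. The recursion starts with
  lifts to \<open>J\<close> of the generators of \<open>I\<close>; there the initial ideal of \<open>I\<close> lies in that of \<open>J\<close> because it is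
  generated in degrees below \<open>N\<close>, and equality of the Hilbert functions makes them equal.\<close>

section \<open>Ascending chains of subgroups with operators\<close>

text \<open>One notion covers ideals, submodules of R^b and submodules of a Rees module, according
  to the choice of \<open>Op\<close>: multiplications, scalings, or scalings together with degree
  shifts. Additivity of the operators is assumed in the lemmas that use it.\<close>

definition op_subgroup :: "('v::ab_group_add \<Rightarrow> 'v) set \<Rightarrow> 'v set \<Rightarrow> bool" where
  "op_subgroup Op K \<longleftrightarrow> 0 \<in> K \<and> (\<forall>x\<in>K. \<forall>y\<in>K. x + y \<in> K) \<and> (\<forall>x\<in>K. - x \<in> K)
     \<and> (\<forall>f\<in>Op. \<forall>x\<in>K. f x \<in> K)"

definition op_noetherian :: "('v::ab_group_add \<Rightarrow> 'v) set \<Rightarrow> 'v set \<Rightarrow> bool" where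
  "op_noetherian Op M \<longleftrightarrow> (\<forall>K :: nat \<Rightarrow> 'v set.
     (\<forall>i. op_subgroup Op (K i) \<and> K i \<subseteq> M \<and> K i \<subseteq> K (Suc i)) \<longrightarrow> (\<exists>n. \<forall>i\<ge>n. K i = K n))"

lemma op_subgroupI:
  assumes "0 \<in> K" "\<And>x y. x \<in> K \<Longrightarrow> y \<in> K \<Longrightarrow> x + y \<in> K" "\<And>x. x \<in> K \<Longrightarrow> - x \<in> K"
    "\<And>f x. f \<in> Op \<Longrightarrow> x \<in> K \<Longrightarrow> f x \<in> K"
  shows "op_subgroup Op K"
  using assms by (auto simp: op_subgroup_def)

lemma op_subgroupD:
  assumes "op_subgroup Op K"
  shows "0 \<in> K" "x \<in> K \<Longrightarrow> y \<in> K \<Longrightarrow> x + y \<in> K" "x \<in> K \<Longrightarrow> - x \<in> K"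
    "x \<in> K \<Longrightarrow> y \<in> K \<Longrightarrow> x - y \<in> K" "f \<in> Op \<Longrightarrow> x \<in> K \<Longrightarrow> f x \<in> K"
  using assms unfolding op_subgroup_def by auto (metis add_uminus_conv_diff)

lemma op_subgroup_Int:
  "op_subgroup Op K \<Longrightarrow> op_subgroup Op L \<Longrightarrow> op_subgroup Op (K \<inter> L)"
  by (auto simp: op_subgroup_def)

lemma op_noetherianD:
  assumes "op_noetherian Op M" "\<And>i. op_subgroup Op (K i)" "\<And>i. K i \<subseteq> M"
    "\<And>i. K i \<subseteq> K (Suc i)"
  obtains n where "\<And>i. i \<ge> n \<Longrightarrow> K i = K n"
  using assms unfolding op_noetherian_def by metis

text \<open>A chain in the image pulls back to a chain in \<open>M\<close>, and each term, lying in
  the image of \<open>M\<close>, is recovered from its preimage. The hypothesis \<open>comm\<close>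
  makes the preimages closed under \<open>Op\<close>.\<close>

lemma op_noetherian_image:
  assumes noe: "op_noetherian Op M" and M: "op_subgroup Op M"
    and add: "\<And>u v. \<phi> (u + v) = \<phi> u + \<phi> v"
    and comm: "\<And>f. f \<in> Op \<Longrightarrow> \<exists>g\<in>Op'. \<forall>v. g (\<phi> v) = \<phi> (f v)"
  shows "op_noetherian Op' (\<phi> ` M)"
  unfolding op_noetherian_def
proof (intro allI impI)
  fix K assume K: "\<forall>i. op_subgroup Op' (K i) \<and> K i \<subseteq> \<phi> ` M \<and> K i \<subseteq> K (Suc i)"
  have zero: "\<phi> 0 = 0" using add[of 0 0] by simp
  have neg: "\<phi> (- v) = - \<phi> v" for v
    using add[of v "- v"] zero by (simp add: eq_neg_iff_add_eq_0 add.commute)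
  have sub: "op_subgroup Op {v \<in> M. \<phi> v \<in> K i}" for i
  proof (rule op_subgroupI)
    fix f x assume "f \<in> Op" "x \<in> {v \<in> M. \<phi> v \<in> K i}"
    then show "f x \<in> {v \<in> M. \<phi> v \<in> K i}"
      using comm[of f] K op_subgroupD(5)[OF M] op_subgroupD(5)[of Op' "K i"]
      by (metis (mono_tags, lifting) mem_Collect_eq)
  qed (use K M in \<open>auto simp: zero neg add op_subgroup_def\<close>)
  obtain n where n: "\<And>i. i \<ge> n \<Longrightarrow> {v \<in> M. \<phi> v \<in> K i} = {v \<in> M. \<phi> v \<in> K n}"
    using op_noetherianD[OF noe, of "\<lambda>i. {v \<in> M. \<phi> v \<in> K i}"] sub K by blast
  have "K i = \<phi> ` {v \<in> M. \<phi> v \<in> K i}" for i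
    using K by blast
  then show "\<exists>n. \<forall>i\<ge>n. K i = K n"
    using n by metis
qed

text \<open>The extension argument: a chain inside M + L is controlled by its intersections with
  \<open>M\<close> and by its residues modulo \<open>M\<close>, which have representatives in
  \<open>L\<close>.\<close>

lemma op_noetherian_plus:
  assumes noeM: "op_noetherian Op M" and noeL: "op_noetherian Op L"
    and M: "op_subgroup Op M" and L: "op_subgroup Op L"
    and add: "\<And>f u v. f \<in> Op \<Longrightarrow> f (u + v) = f u + f v"
  shows "op_noetherian Op {u + v |u v. u \<in> M \<and> v \<in> L}"
  unfolding op_noetherian_def
proof (intro allI impI)
  fix K assume K: "\<forall>i. op_subgroup Op (K i) \<and> K i \<subseteq> {u + v |u v. u \<in> M \<and> v \<in> L} \<and> K i \<subseteq> K (Suc i)"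
  \<comment> \<open>\<open>Q i\<close> consists of the representatives in \<open>L\<close> of the
    classes of \<open>K i\<close> modulo \<open>M\<close>; it stands in for the image of
    \<open>K i\<close> in the quotient by \<open>M\<close>.\<close>
  define Q where "Q i = {v \<in> L. \<exists>u\<in>M. u + v \<in> K i}" for i
  have Q: "op_subgroup Op (Q i)" for i
  proof (rule op_subgroupI)
    have Ki: "op_subgroup Op (K i)" using K by blast
    show "0 \<in> Q i"
      using op_subgroupD(1)[OF Ki] op_subgroupD(1)[OF L] op_subgroupD(1)[OF M]
      unfolding Q_def by force
    fix x assume "x \<in> Q i"
    then obtain u where u: "x \<in> L" "u \<in> M" "u + x \<in> K i" unfolding Q_def by blast
    then have "- u \<in> M" "- x \<in> L" "- u + - x \<in> K i"
      using op_subgroupD(3)[OF L] op_subgroupD(3)[OF M] op_subgroupD(3)[OF Ki, of "u + x"] by auto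
    then show "- x \<in> Q i" unfolding Q_def by blast
    { fix y assume "y \<in> Q i"
      then obtain v where v: "y \<in> L" "v \<in> M" "v + y \<in> K i" unfolding Q_def by blast
      have "(u + v) + (x + y) \<in> K i"
        using op_subgroupD(2)[OF Ki u(3) v(3)] by (simp add: algebra_simps)
      then show "x + y \<in> Q i"
        using op_subgroupD(2)[OF L u(1) v(1)] op_subgroupD(2)[OF M u(2) v(2)]
        unfolding Q_def by blast }
    fix f assume f: "f \<in> Op"
    then have "f u + f x \<in> K i" using op_subgroupD(5)[OF Ki f u(3)] add by metis
    then show "f x \<in> Q i"
      using op_subgroupD(5)[OF L f u(1)] op_subgroupD(5)[OF M f u(2)] unfolding Q_def by blast
  qed
  obtain n1 where n1: "\<And>i. i \<ge> n1 \<Longrightarrow> K i \<inter> M = K n1 \<inter> M"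
    using op_noetherianD[OF noeM, of "\<lambda>i. K i \<inter> M"] K op_subgroup_Int[OF _ M] by blast
  have "Q i \<subseteq> Q (Suc i)" for i using K unfolding Q_def by blast
  then obtain n2 where n2: "\<And>i. i \<ge> n2 \<Longrightarrow> Q i = Q n2"
    using op_noetherianD[OF noeL, of Q] Q unfolding Q_def by blast
  define n where "n = max n1 n2"
  have "K i \<subseteq> K n" if "i \<ge> n" for i
  proof
    fix y assume y: "y \<in> K i"
    have mono: "K n \<subseteq> K i" using lift_Suc_mono_le[of K] K that by blast
    obtain u v where uv: "y = u + v" "u \<in> M" "v \<in> L" using K y by blast
    then have "v \<in> Q i" using y unfolding Q_def by blast
    then have "v \<in> Q n" using n2[of i] n2[of n] that by (simp add: n_def)
    then obtain u' where u': "u' \<in> M" "u' + v \<in> K n" unfolding Q_def by blast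
    \<comment> \<open>Two elements of \<open>K i\<close> with the same \<open>L\<close>-component
      differ by an element of \<open>K i \<inter> M\<close>, which equals
      \<open>K n \<inter> M\<close>.\<close>
    have "(u + v) - (u' + v) \<in> K i"
      using op_subgroupD(4)[of Op "K i"] K y u' uv mono by blast
    then have "u - u' \<in> K i \<inter> M"
      using op_subgroupD(4)[OF M uv(2) u'(1)] by (simp add: algebra_simps)
    then have "u - u' \<in> K n" using n1[of i] n1[of n] that by (auto simp: n_def)
    then have "(u - u') + (u' + v) \<in> K n" using op_subgroupD(2)[of Op "K n"] K u' by blast
    then show "y \<in> K n" by (simp add: uv)
  qed
  then have "K i = K n" if "i \<ge> n" for i
    using that K lift_Suc_mono_le[of K n i] by blast
  then show "\<exists>n. \<forall>i\<ge>n. K i = K n" by blast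
qed

section \<open>Hilbert's basis theorem for groups with operators\<close>

lemma double_chain_stabilises:
  fixes Q :: "nat \<Rightarrow> nat \<Rightarrow> 'v::ab_group_add set"
  assumes noe: "op_noetherian Op M" and sub: "\<And>i j. op_subgroup Op (Q i j)" "\<And>i j. Q i j \<subseteq> M"
    and mono: "\<And>i j. Q i j \<subseteq> Q (Suc i) j" "\<And>i j. Q i j \<subseteq> Q i (Suc j)"
  obtains n where "\<And>i j. j \<ge> n \<Longrightarrow> Q i j = Q i n"
proof -
  have mono1: "Q i j \<subseteq> Q i' j" if "i \<le> i'" for i i' j
    using lift_Suc_mono_le[of "\<lambda>i. Q i j"] mono(1) that by blast
  have mono2: "Q i j \<subseteq> Q i j'" if "j \<le> j'" for i j j'
    using lift_Suc_mono_le[of "Q i"] mono(2) that by blast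
  obtain k where k: "\<And>i. i \<ge> k \<Longrightarrow> Q i i = Q k k"
    using op_noetherianD[OF noe, of "\<lambda>i. Q i i"] sub mono by (metis order_trans)
  \<comment> \<open>A term with both indices at least \<open>k\<close> is squeezed between
    \<open>Q k k\<close> and a later diagonal term, and these two coincide.\<close>
  have large: "Q i j = Q k k" if "i \<ge> k" "j \<ge> k" for i j
    using k[of i] k[of j] mono1[of k i j] mono2[of k j k] mono1[of i "max i j" j]
      mono2[of j "max i j" "max i j"] k[of "max i j"] that by auto
  have "\<exists>n. \<forall>j\<ge>n. Q i j = Q i n" for i
    using op_noetherianD[OF noe, of "Q i"] sub mono by metis
  then obtain f where f: "\<And>i j. j \<ge> f i \<Longrightarrow> Q i j = Q i (f i)" by metis
  \<comment> \<open>Only the finitely many rows \<open>i < k\<close> are left, and each of them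
    stabilises on its own; the rows from \<open>k\<close> on require
    \<open>n \<ge> k\<close>.\<close>
  define n where "n = Max (insert k (f ` {..<k}))"
  have "n \<ge> k" and fn: "i < k \<Longrightarrow> f i \<le> n" for i by (auto simp: n_def)
  have "Q i j = Q i n" if "j \<ge> n" for i j
  proof (cases "i < k")
    case True
    then show ?thesis using f[of i j] f[of i n] fn[of i] that by simp
  next
    case False
    then show ?thesis using large[of i j] large[of i n] \<open>n \<ge> k\<close> that by simp
  qed
  then show ?thesis using that by blast
qed

text \<open>The values at the operator \<open>x\<close> of polynomials of degree below
  \<open>n\<close> with coefficients in \<open>M\<close>; thus the leading terms of
  \<open>op_poly x M (Suc n)\<close> sit in degree \<open>n\<close>.\<close>

primrec op_poly :: "('v::ab_group_add \<Rightarrow> 'v) \<Rightarrow> 'v set \<Rightarrow> nat \<Rightarrow> 'v set" where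
  "op_poly x M 0 = {0}"
| "op_poly x M (Suc n) = {w + (x ^^ n) u |w u. w \<in> op_poly x M n \<and> u \<in> M}"

text \<open>Hilbert's basis theorem. The expressions of degree at most \<open>n\<close> in \<open>x\<close> need not be unique, but
  the leading coefficient argument does not require it.\<close>

lemma op_noetherian_adjoin:
  assumes noe: "op_noetherian Op M" and M: "op_subgroup Op M"
    and add: "\<And>f u v. f \<in> insert x Op \<Longrightarrow> f (u + v) = f u + f v"
    and comm: "\<And>f u. f \<in> Op \<Longrightarrow> f (x u) = x (f u)"
  obtains M' where "op_subgroup (insert x Op) M'" "M \<subseteq> M'" "op_noetherian (insert x Op) M'"
proof -
  let ?P = "op_poly x M"
  have zero: "f 0 = 0" if "f \<in> insert x Op" for f using add[OF that, of 0 0] by simp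
  have neg: "f (- v) = - f v" if "f \<in> insert x Op" for f v
    using add[OF that, of v "- v"] zero[OF that] by (simp add: eq_neg_iff_add_eq_0 add.commute)
  have powadd: "(x ^^ n) (u + v) = (x ^^ n) u + (x ^^ n) v" for n u v
    by (induction n) (auto simp: add)
  have powneg: "(x ^^ n) (- u) = - (x ^^ n) u" for n u
    by (induction n) (auto simp: neg)
  have pow0: "(x ^^ n) 0 = 0" for n
    by (induction n) (auto simp: zero)
  have powcomm: "f ((x ^^ n) u) = (x ^^ n) (f u)" if "f \<in> Op" for f n u
    by (induction n) (auto simp: comm that)
  have P: "op_subgroup Op (?P n)" for n
  proof (induction n)
    case 0 then show ?case by (auto simp: op_subgroup_def zero)
  next
    case (Suc n)
    show ?case
    proof (rule op_subgroupI)
      show "0 \<in> ?P (Suc n)"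
        using op_subgroupD(1)[OF Suc] op_subgroupD(1)[OF M] pow0[of n] by force
      fix y assume "y \<in> ?P (Suc n)"
      then obtain w u where y: "y = w + (x ^^ n) u" "w \<in> ?P n" "u \<in> M" by auto
      show "- y \<in> ?P (Suc n)"
        using op_subgroupD(3)[OF Suc y(2)] op_subgroupD(3)[OF M y(3)]
        unfolding op_poly.simps y by (intro CollectI exI[of _ "- w"] exI[of _ "- u"]) (simp add: powneg)
      { fix z assume "z \<in> ?P (Suc n)"
        then obtain w' u' where z: "z = w' + (x ^^ n) u'" "w' \<in> ?P n" "u' \<in> M" by auto
        show "y + z \<in> ?P (Suc n)"
          using op_subgroupD(2)[OF Suc y(2) z(2)] op_subgroupD(2)[OF M y(3) z(3)]
          unfolding op_poly.simps y z
          by (intro CollectI exI[of _ "w + w'"] exI[of _ "u + u'"]) (simp add: powadd algebra_simps) }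
      fix f assume f: "f \<in> Op"
      then show "f y \<in> ?P (Suc n)"
        using op_subgroupD(5)[OF Suc f y(2)] op_subgroupD(5)[OF M f y(3)]
        unfolding op_poly.simps y by (intro CollectI exI[of _ "f w"] exI[of _ "f u"]) (simp add: add powcomm f)
    qed
  qed
  have Pmono: "?P n \<subseteq> ?P (Suc n)" for n
    using op_subgroupD(1)[OF M] pow0[of n] by force
  have Px: "x y \<in> ?P (Suc n)" if "y \<in> ?P n" for y n
    using that
  proof (induction n arbitrary: y)
    case 0
    then show ?case using Pmono[of 0] by (auto simp: zero)
  next
    case (Suc n)
    then obtain w u where y: "y = w + (x ^^ n) u" "w \<in> ?P n" "u \<in> M" by auto
    have "x w \<in> ?P (Suc n)" using Suc.IH y by blast
    then show ?case
      unfolding op_poly.simps(2)[of x M "Suc n"] using y by (auto simp: add simp del: op_poly.simps)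
  qed
  define M' where "M' = (\<Union>n. ?P n)"
  have Pmono': "?P i \<subseteq> ?P j" if "i \<le> j" for i j
    using lift_Suc_mono_le[of ?P] Pmono that by blast
  have M': "op_subgroup (insert x Op) M'"
  proof (rule op_subgroupI)
    show "0 \<in> M'" unfolding M'_def using op_subgroupD(1)[OF P] by blast
    fix y assume "y \<in> M'"
    then obtain n where n: "y \<in> ?P n" unfolding M'_def by blast
    show "- y \<in> M'" unfolding M'_def using op_subgroupD(3)[OF P n] by blast
    { fix z assume "z \<in> M'"
      then obtain k where k: "z \<in> ?P k" unfolding M'_def by blast
      have "y + z \<in> ?P (max n k)"
        using op_subgroupD(2)[OF P[of "max n k"]] Pmono'[of n "max n k"] Pmono'[of k "max n k"] n k
        by auto
      then show "y + z \<in> M'" unfolding M'_def by blast }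
    fix f assume "f \<in> insert x Op"
    then show "f y \<in> M'"
      unfolding M'_def using op_subgroupD(5)[OF P _ n, of f] Px[OF n] by blast
  qed
  moreover have "M \<subseteq> M'"
  proof
    fix u assume "u \<in> M"
    then have "u \<in> ?P (Suc 0)" by auto
    then show "u \<in> M'" unfolding M'_def by blast
  qed
  moreover have "op_noetherian (insert x Op) M'"
    unfolding op_noetherian_def
  proof (intro allI impI)
    fix K assume K: "\<forall>i. op_subgroup (insert x Op) (K i) \<and> K i \<subseteq> M' \<and> K i \<subseteq> K (Suc i)"
    \<comment> \<open>\<open>Q i j\<close> collects the leading coefficients of the elements of
      \<open>K j\<close> written in degree \<open>i\<close>. Applying \<open>x\<close> gives growth
      in \<open>i\<close>, the chain gives growth in \<open>j\<close>.\<close>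
    define Q where "Q i j = {u \<in> M. \<exists>w\<in>?P i. w + (x ^^ i) u \<in> K j}" for i j
    have Q: "op_subgroup Op (Q i j)" for i j
    proof (rule op_subgroupI)
      have Kj: "op_subgroup (insert x Op) (K j)" using K by blast
      have "0 + (x ^^ i) 0 \<in> K j" using op_subgroupD(1)[OF Kj] pow0 by simp
      then show "0 \<in> Q i j"
        using op_subgroupD(1)[OF M] op_subgroupD(1)[OF P[of i]] unfolding Q_def by blast
      fix u assume "u \<in> Q i j"
      then obtain w where w: "u \<in> M" "w \<in> ?P i" "w + (x ^^ i) u \<in> K j" unfolding Q_def by blast
      have "- w + (x ^^ i) (- u) \<in> K j"
        using op_subgroupD(3)[OF Kj w(3)] by (simp add: powneg)
      then show "- u \<in> Q i j"
        using op_subgroupD(3)[OF M w(1)] op_subgroupD(3)[OF P w(2)] unfolding Q_def by blast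
      { fix v assume "v \<in> Q i j"
        then obtain z where z: "v \<in> M" "z \<in> ?P i" "z + (x ^^ i) v \<in> K j" unfolding Q_def by blast
        have "(w + z) + (x ^^ i) (u + v) \<in> K j"
          using op_subgroupD(2)[OF Kj w(3) z(3)] by (simp add: powadd algebra_simps)
        then show "u + v \<in> Q i j"
          using op_subgroupD(2)[OF M w(1) z(1)] op_subgroupD(2)[OF P w(2) z(2)]
          unfolding Q_def by blast }
      fix f assume f: "f \<in> Op"
      have "f w + (x ^^ i) (f u) \<in> K j"
        using op_subgroupD(5)[OF Kj _ w(3), of f] f by (simp add: add powcomm)
      then show "f u \<in> Q i j"
        using op_subgroupD(5)[OF M f w(1)] op_subgroupD(5)[OF P f w(2)] unfolding Q_def by blast
    qed
    have Q1: "Q i j \<subseteq> Q (Suc i) j" for i j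
    proof
      fix u assume "u \<in> Q i j"
      then obtain w where w: "u \<in> M" "w \<in> ?P i" "w + (x ^^ i) u \<in> K j" unfolding Q_def by blast
      have "x w + (x ^^ Suc i) u \<in> K j"
        using op_subgroupD(5)[of "insert x Op" "K j" x, OF _ _ w(3)] K by (simp add: add)
      then show "u \<in> Q (Suc i) j" using w Px[OF w(2)] unfolding Q_def by blast
    qed
    have Q2: "Q i j \<subseteq> Q i (Suc j)" for i j using K unfolding Q_def by blast
    obtain n where n: "\<And>i j. j \<ge> n \<Longrightarrow> Q i j = Q i n"
      using double_chain_stabilises[OF noe, of Q] Q Q1 Q2 unfolding Q_def by blast
    have "K j = K n" if j: "j \<ge> n" for j
    proof
      show mono: "K n \<subseteq> K j" using lift_Suc_mono_le[of K n j] K j by blast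
      \<comment> \<open>Induction on the degree: some element of \<open>K n\<close> has the same
        leading coefficient as \<open>y\<close>, and the difference is an element of
        \<open>K j\<close> of lower degree.\<close>
      have "y \<in> K n" if "y \<in> K j" "y \<in> ?P i" for y i
        using that
      proof (induction i arbitrary: y)
        case 0
        then show ?case using K op_subgroupD(1)[of "insert x Op" "K n"] by auto
      next
        case (Suc i)
        then obtain w u where y: "y = w + (x ^^ i) u" "w \<in> ?P i" "u \<in> M" by auto
        then have "u \<in> Q i n" using n[OF j, of i] Suc.prems unfolding Q_def by blast
        then obtain z where z: "z \<in> ?P i" "z + (x ^^ i) u \<in> K n" unfolding Q_def by blast
        have "y - (z + (x ^^ i) u) \<in> K j"
          using op_subgroupD(4)[of _ "K j"] K Suc.prems z mono by blast
        then have "w - z \<in> K n"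
          using Suc.IH op_subgroupD(4)[OF P y(2) z(1)] y by simp
        then have "(w - z) + (z + (x ^^ i) u) \<in> K n"
          using op_subgroupD(2)[of _ "K n"] K z by blast
        then show ?case by (simp add: y)
      qed
      then show "K j \<subseteq> K n" using K unfolding M'_def by blast
    qed
    then show "\<exists>n. \<forall>i\<ge>n. K i = K n" by blast
  qed
  ultimately show ?thesis using that by blast
qed

lemma op_noetherian_adjoin_finite:
  assumes "finite X" and "op_noetherian Op M" and "op_subgroup Op M"
    and "\<And>f u v. f \<in> X \<union> Op \<Longrightarrow> f (u + v) = f u + f v"
    and "\<And>f g u. f \<in> X \<union> Op \<Longrightarrow> g \<in> X \<Longrightarrow> f (g u) = g (f u)"
  shows "\<exists>M'. op_subgroup (X \<union> Op) M' \<and> M \<subseteq> M' \<and> op_noetherian (X \<union> Op) M'"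
  using assms
proof (induction X rule: finite_induct)
  case empty
  then show ?case by auto
next
  case (insert x X)
  have "\<exists>M1. op_subgroup (X \<union> Op) M1 \<and> M \<subseteq> M1 \<and> op_noetherian (X \<union> Op) M1"
    by (rule insert.IH) (use insert.prems in blast)+
  then obtain M1 where M1: "op_subgroup (X \<union> Op) M1" "M \<subseteq> M1" "op_noetherian (X \<union> Op) M1"
    by blast
  obtain M' where "op_subgroup (insert x (X \<union> Op)) M'" "M1 \<subseteq> M'"
      "op_noetherian (insert x (X \<union> Op)) M'"
    by (rule op_noetherian_adjoin[OF M1(3,1), of x]) (use insert.prems in blast)+
  then show ?case using M1 by auto
qed

section \<open>Ideals and submodules\<close>

text \<open>Named so that \<open>range scl\<close> can serve as a set of operators, whose invariant
  subgroups are exactly the submodules.\<close>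

definition scl :: "'a::comm_ring_1 \<Rightarrow> (nat \<Rightarrow> 'a) \<Rightarrow> nat \<Rightarrow> 'a" where
  "scl r v = (\<lambda>j. r * v j)"

lemma scl_apply [simp]: "scl r v j = r * v j"
  by (simp add: scl_def)

lemma scl_add: "scl r (u + v) = scl r u + scl r v"
  by (auto simp: scl_def distrib_left)

lemma scl_scl: "scl r (scl q v) = scl (r * q) v"
  by (auto simp: scl_def mult.assoc)

lemma is_ideal_iff: "is_ideal I \<longleftrightarrow> op_subgroup (range (*)) I"
proof
  assume I: "is_ideal I"
  then have "- x \<in> I" if "x \<in> I" for x
    using that unfolding is_ideal_def by (metis mult_minus1)
  then show "op_subgroup (range (*)) I"
    using I by (auto simp: is_ideal_def op_subgroup_def)
qed (auto simp: is_ideal_def op_subgroup_def)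

lemma is_submod_iff: "is_submod L \<longleftrightarrow> op_subgroup (range scl) L"
proof
  assume L: "is_submod L"
  have "- x \<in> L" if "x \<in> L" for x
  proof -
    have "- x = (\<lambda>j. (- 1) * x j)" by auto
    then show ?thesis using L that unfolding is_submod_def by metis
  qed
  then show "op_subgroup (range scl) L"
    using L by (auto simp: is_submod_def op_subgroup_def scl_def plus_fun_def zero_fun_def)
qed (auto simp: is_submod_def op_subgroup_def scl_def plus_fun_def zero_fun_def)

lemma is_idealD:
  assumes "is_ideal I"
  shows "0 \<in> I" "x \<in> I \<Longrightarrow> y \<in> I \<Longrightarrow> x + y \<in> I" "x \<in> I \<Longrightarrow> - x \<in> I"
    "x \<in> I \<Longrightarrow> y \<in> I \<Longrightarrow> x - y \<in> I" "x \<in> I \<Longrightarrow> r * x \<in> I" "x \<in> I \<Longrightarrow> x * r \<in> I"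
proof -
  note D = op_subgroupD[OF assms[unfolded is_ideal_iff]]
  show "0 \<in> I" "x \<in> I \<Longrightarrow> y \<in> I \<Longrightarrow> x + y \<in> I" "x \<in> I \<Longrightarrow> - x \<in> I"
    "x \<in> I \<Longrightarrow> y \<in> I \<Longrightarrow> x - y \<in> I" "x \<in> I \<Longrightarrow> r * x \<in> I"
    by (fact D D(5)[of "(*) r", OF rangeI])+
  then show "x \<in> I \<Longrightarrow> x * r \<in> I" by (simp add: mult.commute)
qed

lemma is_submodD:
  assumes "is_submod L"
  shows "0 \<in> L" "x \<in> L \<Longrightarrow> y \<in> L \<Longrightarrow> x + y \<in> L" "x \<in> L \<Longrightarrow> - x \<in> L"
    "x \<in> L \<Longrightarrow> y \<in> L \<Longrightarrow> x - y \<in> L" "x \<in> L \<Longrightarrow> scl r x \<in> L"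
proof -
  note D = op_subgroupD[OF assms[unfolded is_submod_iff]]
  show "0 \<in> L" "x \<in> L \<Longrightarrow> y \<in> L \<Longrightarrow> x + y \<in> L" "x \<in> L \<Longrightarrow> - x \<in> L"
    "x \<in> L \<Longrightarrow> y \<in> L \<Longrightarrow> x - y \<in> L" "x \<in> L \<Longrightarrow> scl r x \<in> L"
    by (fact D D(5)[of "scl r", OF rangeI])+
qed

lemma is_submodI:
  assumes "0 \<in> L" "\<And>x y. x \<in> L \<Longrightarrow> y \<in> L \<Longrightarrow> x + y \<in> L" "\<And>r x. x \<in> L \<Longrightarrow> scl r x \<in> L"
  shows "is_submod L"
  using assms unfolding is_submod_def scl_def plus_fun_def zero_fun_def by blast

lemma is_idealI:
  assumes "0 \<in> L" "\<And>x y. x \<in> L \<Longrightarrow> y \<in> L \<Longrightarrow> x + y \<in> L" "\<And>r x. x \<in> L \<Longrightarrow> r * x \<in> L"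
  shows "is_ideal L"
  using assms unfolding is_ideal_def by blast

lemma is_ideal_sum:
  assumes "is_ideal I" and "\<And>c. c \<in> A \<Longrightarrow> f c \<in> I"
  shows "sum f A \<in> I"
  using assms(2) by (induction A rule: infinite_finite_induct) (auto intro: is_idealD[OF assms(1)])

lemma is_ideal_gen: "is_ideal (ideal_gen S)"
  by (auto simp: ideal_gen_def is_ideal_def)

lemma ideal_gen_superset: "S \<subseteq> ideal_gen S"
  by (auto simp: ideal_gen_def)

lemma ideal_gen_subset: "is_ideal J \<Longrightarrow> S \<subseteq> J \<Longrightarrow> ideal_gen S \<subseteq> J"
  by (auto simp: ideal_gen_def)

lemma is_submod_ideal_smult: "is_submod (ideal_smult A L)"
  by (auto simp: ideal_smult_def submod_gen_def is_submod_def)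

lemma ideal_smult_memI: "a \<in> A \<Longrightarrow> v \<in> L \<Longrightarrow> scl a v \<in> ideal_smult A L"
  by (auto simp: ideal_smult_def submod_gen_def scl_def)

lemma ideal_smult_subset:
  assumes "is_submod T" "\<And>a v. a \<in> A \<Longrightarrow> v \<in> L \<Longrightarrow> scl a v \<in> T"
  shows "ideal_smult A L \<subseteq> T"
  unfolding ideal_smult_def submod_gen_def
  by (rule Inter_lower) (use assms in \<open>auto simp: scl_def\<close>)

lemma ideal_smult_mono: "A \<subseteq> B \<Longrightarrow> L \<subseteq> K \<Longrightarrow> ideal_smult A L \<subseteq> ideal_smult B K"
  by (rule ideal_smult_subset[OF is_submod_ideal_smult]) (auto intro: ideal_smult_memI)

lemma ideal_smult_UNIV: "is_submod L \<Longrightarrow> ideal_smult UNIV L = L"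
proof
  assume L: "is_submod L"
  show "ideal_smult UNIV L \<subseteq> L" by (rule ideal_smult_subset[OF L]) (rule is_submodD(5)[OF L])
  show "L \<subseteq> ideal_smult UNIV L"
  proof
    fix v assume "v \<in> L"
    then show "v \<in> ideal_smult UNIV L" using ideal_smult_memI[of 1 UNIV v L] by (simp add: scl_def)
  qed
qed

lemma is_ideal_UNIV: "is_ideal UNIV"
  by (simp add: is_ideal_def)

text \<open>This colon ideal reduces a claim about all multipliers from an ideal to its
  generators.\<close>

lemma is_ideal_colon:
  assumes "is_submod T" shows "is_ideal {x. scl x v \<in> T}"
proof (rule is_idealI)
  have "scl 0 v = 0" by auto
  then show "0 \<in> {x. scl x v \<in> T}" using is_submodD(1)[OF assms] by simp
next
  fix x y assume "x \<in> {x. scl x v \<in> T}" "y \<in> {x. scl x v \<in> T}"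
  moreover have "scl (x + y) v = scl x v + scl y v" by (auto simp: distrib_right)
  ultimately show "x + y \<in> {x. scl x v \<in> T}" using is_submodD(2)[OF assms] by simp
next
  fix r x assume "x \<in> {x. scl x v \<in> T}"
  then show "r * x \<in> {x. scl x v \<in> T}"
    using is_submodD(5)[OF assms, of "scl x v" r] by (simp add: scl_scl)
qed

lemma is_ideal_ideal_pow: "is_ideal (ideal_pow m n)"
  by (cases n) (auto simp: is_ideal_UNIV is_ideal_gen)

lemma ideal_pow_mult: "a \<in> ideal_pow m i \<Longrightarrow> c \<in> ideal_pow m j \<Longrightarrow> a * c \<in> ideal_pow m (i + j)"
proof (induction i arbitrary: a c)
  case 0
  then show ?case using is_idealD(5)[OF is_ideal_ideal_pow] by simp
next
  case (Suc i)
  \<comment> \<open>The multipliers of \<open>c\<close> into the target power form an ideal, so only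
    the products generating \<open>ideal_pow m (Suc i)\<close> have to be checked.\<close>
  let ?T = "{x. x * c \<in> ideal_pow m (Suc i + j)}"
  have "is_ideal ?T"
    using is_ideal_ideal_pow[of m "Suc i + j"]
    by (auto simp: is_ideal_def distrib_right mult.assoc simp del: ideal_pow.simps)
  moreover have "{a * b |a b. a \<in> m \<and> b \<in> ideal_pow m i} \<subseteq> ?T"
  proof clarify
    fix x y assume "x \<in> m" "y \<in> ideal_pow m i"
    then have "x * (y * c) \<in> {a * b |a b. a \<in> m \<and> b \<in> ideal_pow m (i + j)}"
      using Suc.IH[of y c] Suc.prems(2) by blast
    then show "x * y * c \<in> ideal_pow m (Suc i + j)"
      using ideal_gen_superset[THEN subsetD, of "x * (y * c)"] by (simp add: mult.assoc)
  qed
  ultimately have "ideal_pow m (Suc i) \<subseteq> ?T"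
    unfolding ideal_pow.simps(2)[of m i] by (rule ideal_gen_subset)
  then show ?case using Suc.prems(1) by blast
qed

lemma ideal_pow_1: "a \<in> m \<Longrightarrow> a \<in> ideal_pow m (Suc 0)"
  using ideal_gen_superset[of "{a * b |a b. a \<in> m}", THEN subsetD, of "a * 1"] by fastforce

lemma ideal_pow_antimono: "i \<le> j \<Longrightarrow> ideal_pow m j \<subseteq> ideal_pow m i"
proof (induction j rule: dec_induct)
  case (step n)
  have "ideal_pow m (Suc n) \<subseteq> ideal_pow m n"
    unfolding ideal_pow.simps
    by (rule ideal_gen_subset[OF is_ideal_ideal_pow]) (auto intro: is_idealD[OF is_ideal_ideal_pow])
  then show ?case using step by blast
qed simp

text \<open>A factor of \<open>m\<close> can be split off on either side: on the outside for
  induction on the degree in a Rees module, on the inside to compare consecutive terms of the chain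
  in the Artin--Rees argument.\<close>

lemma ideal_smult_pow_Suc:
  shows "ideal_smult (ideal_pow m (Suc n)) L \<subseteq> ideal_smult m (ideal_smult (ideal_pow m n) L)"
    and "ideal_smult (ideal_pow m (Suc n)) L \<subseteq> ideal_smult (ideal_pow m n) (ideal_smult m L)"
proof -
  have *: "ideal_smult (ideal_pow m (Suc n)) L \<subseteq> T"
    if T: "is_submod T" and mem: "\<And>a c v. a \<in> m \<Longrightarrow> c \<in> ideal_pow m n \<Longrightarrow> v \<in> L \<Longrightarrow> scl (a * c) v \<in> T"
    for T
  proof (rule ideal_smult_subset[OF T])
    fix a v assume a: "a \<in> ideal_pow m (Suc n)" and v: "v \<in> L"
    have "ideal_pow m (Suc n) \<subseteq> {x. scl x v \<in> T}"
      unfolding ideal_pow.simps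
      by (rule ideal_gen_subset[OF is_ideal_colon[OF T]]) (use mem v in auto)
    then show "scl a v \<in> T" using a by blast
  qed
  show "ideal_smult (ideal_pow m (Suc n)) L \<subseteq> ideal_smult m (ideal_smult (ideal_pow m n) L)"
    by (rule *[OF is_submod_ideal_smult]) (auto simp: scl_scl[symmetric] intro!: ideal_smult_memI)
  show "ideal_smult (ideal_pow m (Suc n)) L \<subseteq> ideal_smult (ideal_pow m n) (ideal_smult m L)"
    by (rule *[OF is_submod_ideal_smult])
      (subst mult.commute, auto simp: scl_scl[symmetric] intro!: ideal_smult_memI)
qed

section \<open>Finite free modules and their \<open>m\<close>-adic filtration\<close>

lemma is_submod_fvec: "is_submod (fvec b)"
  by (auto simp: is_submod_def fvec_def)

lemma ideal_smult_fvec: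
  "ideal_smult (ideal_pow m n) (fvec b) = {v \<in> fvec b. \<forall>j. v j \<in> ideal_pow m n}"
proof
  have "is_submod {v \<in> fvec b. \<forall>j. v j \<in> ideal_pow m n}"
    using is_ideal_ideal_pow[of m n] by (auto simp: is_submod_def fvec_def is_ideal_def)
  then show "ideal_smult (ideal_pow m n) (fvec b) \<subseteq> {v \<in> fvec b. \<forall>j. v j \<in> ideal_pow m n}"
    by (rule ideal_smult_subset) (auto simp: fvec_def intro: is_idealD[OF is_ideal_ideal_pow])
  show "{v \<in> fvec b. \<forall>j. v j \<in> ideal_pow m n} \<subseteq> ideal_smult (ideal_pow m n) (fvec b)"
  proof clarify
    fix v assume v: "v \<in> fvec b" "\<forall>j. v j \<in> ideal_pow m n"
    \<comment> \<open>The first \<open>c\<close> coordinates of \<open>v\<close> are assembled one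
      standard basis vector at a time; for \<open>c = b\<close> the result is
      \<open>v\<close>.\<close>
    have "(\<lambda>j. if j < c then v j else 0) \<in> ideal_smult (ideal_pow m n) (fvec b)" if "c \<le> b" for c
      using that
    proof (induction c)
      case 0
      then show ?case using is_submodD(1)[OF is_submod_ideal_smult] by (simp add: zero_fun_def)
    next
      case (Suc c)
      have "(\<lambda>j. if j = c then 1 else 0) \<in> fvec b" using Suc.prems by (auto simp: fvec_def)
      then have "scl (v c) (\<lambda>j. if j = c then 1 else 0) \<in> ideal_smult (ideal_pow m n) (fvec b)"
        using v(2) ideal_smult_memI by blast
      moreover have "(\<lambda>j. if j < Suc c then v j else 0)
          = (\<lambda>j. if j < c then v j else 0) + scl (v c) (\<lambda>j. if j = c then 1 else 0)"
        by (auto simp: fun_eq_iff less_Suc_eq)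
      ultimately show ?case using Suc is_submodD(2)[OF is_submod_ideal_smult] by simp
    qed
    moreover have "(\<lambda>j. if j < b then v j else 0) = v" using v(1) by (auto simp: fvec_def)
    ultimately show "v \<in> ideal_smult (ideal_pow m n) (fvec b)" by (metis order_refl)
  qed
qed

section \<open>The Artin--Rees lemma and Nakayama's lemma\<close>

lemma op_noetherian_ring:
  assumes "noetherian_ring TYPE('a::comm_ring_1)"
  shows "op_noetherian (range (*)) (UNIV :: 'a set)"
  unfolding op_noetherian_def
proof (intro allI impI)
  fix K :: "nat \<Rightarrow> 'a set"
  assume "\<forall>i. op_subgroup (range (*)) (K i) \<and> K i \<subseteq> UNIV \<and> K i \<subseteq> K (Suc i)"
  then have K: "is_ideal (K i)" "K i \<subseteq> K (Suc i)" for i by (auto simp: is_ideal_iff)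
  have mono: "K i \<subseteq> K j" if "i \<le> j" for i j using lift_Suc_mono_le[of K] K(2) that by blast
  have "is_ideal (\<Union>i. K i)"
  proof (rule is_idealI)
    fix x y assume "x \<in> (\<Union>i. K i)" "y \<in> (\<Union>i. K i)"
    then obtain i j where "x \<in> K i" "y \<in> K j" by blast
    then have "x + y \<in> K (max i j)"
      using is_idealD(2)[OF K(1), of x "max i j" y] mono[of i "max i j"] mono[of j "max i j"] by auto
    then show "x + y \<in> (\<Union>i. K i)" by blast
  qed (use is_idealD(1,5)[OF K(1)] in blast)+
  from assms[unfolded noetherian_ring_def, rule_format, OF this]
  obtain S where S: "finite S" "(\<Union>i. K i) = ideal_gen S" by blast
  then have "\<forall>x\<in>S. \<exists>i. x \<in> K i" using ideal_gen_superset by blast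
  then obtain f where f: "\<And>x. x \<in> S \<Longrightarrow> x \<in> K (f x)" by metis
  \<comment> \<open>The finitely many generators of the union all lie in one term of the chain; the
    inserted 0 covers an empty \<open>S\<close>.\<close>
  define n where "n = Max (insert 0 (f ` S))"
  have "f x \<le> n" if "x \<in> S" for x using that S(1) by (simp add: n_def)
  then have "S \<subseteq> K n" using f mono by blast
  then have "(\<Union>i. K i) \<subseteq> K n" using S(2) ideal_gen_subset[OF K(1)] by simp
  then show "\<exists>n. \<forall>i\<ge>n. K i = K n" using mono by blast
qed

lemma op_noetherian_fvec:
  assumes "noetherian_ring TYPE('a::comm_ring_1)"
  shows "op_noetherian (range scl) (fvec b :: (nat \<Rightarrow> 'a) set)"
proof (induction b)
  case 0
  have "fvec 0 = {0 :: nat \<Rightarrow> 'a}" by (auto simp: fvec_def zero_fun_def)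
  then show ?case
    unfolding op_noetherian_def op_subgroup_def by (metis empty_iff subset_singletonD)
next
  case (Suc b)
  \<comment> \<open>\<open>\<phi>\<close> embeds R as coordinate \<open>b\<close>, which makes
    R^(b+1) the sum of R^b and an image of R.\<close>
  define \<phi> where "\<phi> a = (\<lambda>j. if j = b then a else 0)" for a :: 'a
  have UNIV: "op_subgroup (range (*)) (UNIV :: 'a set)" by (auto simp: op_subgroup_def)
  have "op_noetherian (range scl) (range \<phi>)"
  proof (rule op_noetherian_image[OF op_noetherian_ring[OF assms] UNIV])
    show "\<phi> (u + v) = \<phi> u + \<phi> v" for u v by (auto simp: \<phi>_def)
    show "\<exists>g\<in>range scl. \<forall>v. g (\<phi> v) = \<phi> (f v)" if f: "f \<in> range (*)" for f
    proof -
      obtain r where "f = (*) r" using f by blast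
      then show ?thesis by (intro bexI[of _ "scl r"]) (auto simp: \<phi>_def)
    qed
  qed
  moreover have "is_submod (range \<phi>)"
  proof (rule is_submodI)
    show "0 \<in> range \<phi>" by (rule range_eqI[of _ _ 0]) (auto simp: \<phi>_def)
    show "x + y \<in> range \<phi>" if "x \<in> range \<phi>" "y \<in> range \<phi>" for x y
    proof -
      have "\<phi> a + \<phi> c = \<phi> (a + c)" for a c by (auto simp: \<phi>_def)
      then show ?thesis using that by auto
    qed
    show "scl r x \<in> range \<phi>" if "x \<in> range \<phi>" for r x
    proof -
      have "scl r (\<phi> a) = \<phi> (r * a)" for a by (auto simp: \<phi>_def)
      then show ?thesis using that by auto
    qed
  qed
  ultimately have "op_noetherian (range scl) {u + v |u v. u \<in> fvec b \<and> v \<in> range \<phi>}"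
    using op_noetherian_plus[of "range scl" "fvec b" "range \<phi>"] Suc is_submod_fvec[of b]
    unfolding is_submod_iff using scl_add by blast
  moreover have "fvec (Suc b) = {u + v |u v. u \<in> fvec b \<and> v \<in> range \<phi>}"
  proof (intro equalityI subsetI)
    fix v :: "nat \<Rightarrow> 'a" assume v: "v \<in> fvec (Suc b)"
    have "v = v(b := 0) + \<phi> (v b)" by (auto simp: \<phi>_def)
    moreover have "v(b := 0) \<in> fvec b" using v by (auto simp: fvec_def)
    ultimately show "v \<in> {u + v |u v. u \<in> fvec b \<and> v \<in> range \<phi>}" by blast
  qed (auto simp: fvec_def \<phi>_def)
  ultimately show ?case by (simp only:)
qed

text \<open>The Rees module, the direct sum of the m^n F, is Noetherian over the Rees ring by
  Hilbert's basis theorem. Its submodules generated by the components m^i F \<inter> L with i \<le>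
  j form an ascending chain in \<open>j\<close>, and \<open>s\<close> is an index from which it is
  stationary.\<close>

theorem Artin_Rees:
  fixes m :: "'a::comm_ring_1 set"
  assumes noeth: "noetherian_ring TYPE('a)" and m: "is_ideal m" and L: "is_submod L"
  shows "\<exists>s. \<forall>n\<ge>s. ideal_smult (ideal_pow m n) (fvec b) \<inter> L
       = ideal_smult (ideal_pow m (n - s)) (ideal_smult (ideal_pow m s) (fvec b) \<inter> L)"
proof -
  let ?F = "\<lambda>n. ideal_smult (ideal_pow m n) (fvec b)"
  obtain S where S: "finite S" "m = ideal_gen S"
    using noeth m unfolding noetherian_ring_def by blast
  \<comment> \<open>The Rees module is realised by sequences of vectors: the entry at \<open>n\<close> is the component of
    degree \<open>n\<close>.\<close>
  define single :: "nat \<Rightarrow> (nat \<Rightarrow> 'a) \<Rightarrow> nat \<Rightarrow> nat \<Rightarrow> 'a" where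
    "single n v = (\<lambda>k. if k = n then v else 0)" for n v
  define sc :: "'a \<Rightarrow> (nat \<Rightarrow> nat \<Rightarrow> 'a) \<Rightarrow> nat \<Rightarrow> nat \<Rightarrow> 'a" where
    "sc r w = (\<lambda>k. scl r (w k))" for r w
  \<comment> \<open>\<open>shift r\<close> models multiplication by r t, which raises the degree by
    one; \<open>sc r\<close> is multiplication by the constant r.\<close>
  define shift :: "'a \<Rightarrow> (nat \<Rightarrow> nat \<Rightarrow> 'a) \<Rightarrow> nat \<Rightarrow> nat \<Rightarrow> 'a" where
    "shift r w = (\<lambda>k. case k of 0 \<Rightarrow> 0 | Suc k \<Rightarrow> scl r (w k))" for r w
  let ?Op = "shift ` S \<union> range sc"
  have single_add: "single n (u + v) = single n u + single n v" for n u v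
    by (auto simp: single_def)
  have sc_single: "sc r (single n v) = single n (scl r v)" for r n v
    by (auto simp: single_def sc_def fun_eq_iff)
  have shift_single: "shift r (single n v) = single (Suc n) (scl r v)" for r n v
    by (auto simp: single_def shift_def fun_eq_iff split: nat.splits)
  have "op_noetherian (range sc) (single 0 ` fvec b)"
    by (rule op_noetherian_image[OF op_noetherian_fvec[OF noeth]])
      (use is_submod_fvec in \<open>auto simp: is_submod_iff single_add sc_single\<close>)
  moreover have "op_subgroup (range sc) (single 0 ` fvec b)"
  proof -
    have zero: "single 0 0 = 0" by (auto simp: single_def)
    have neg: "- single 0 v = single 0 (- v)" for v by (auto simp: single_def fun_eq_iff)
    note D = is_submodD[OF is_submod_fvec]
    show ?thesis
    proof (rule op_subgroupI)
      show "0 \<in> single 0 ` fvec b" using D(1) zero by (metis imageI)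
      fix x assume "x \<in> single 0 ` fvec b"
      then obtain u where u: "x = single 0 u" "u \<in> fvec b" by blast
      show "- x \<in> single 0 ` fvec b" unfolding u neg by (rule imageI[OF D(3)[OF u(2)]])
      show "x + y \<in> single 0 ` fvec b" if y: "y \<in> single 0 ` fvec b" for y
      proof -
        obtain v where v: "y = single 0 v" "v \<in> fvec b" using y by blast
        show ?thesis unfolding u v single_add[symmetric] by (rule imageI[OF D(2)[OF u(2) v(2)]])
      qed
      show "f x \<in> single 0 ` fvec b" if f: "f \<in> range sc" for f
      proof -
        obtain r where r: "f = sc r" using f by blast
        show ?thesis unfolding u r sc_single by (rule imageI[OF D(5)[OF u(2)]])
      qed
    qed
  qed
  moreover have "f (u + v) = f u + f v" if "f \<in> ?Op" for f u v
    using that by (auto simp: sc_def shift_def scl_add fun_eq_iff distrib_left split: nat.splits)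
  moreover have "f (g u) = g (f u)" if "f \<in> ?Op" "g \<in> shift ` S" for f g u
    using that by (auto simp: sc_def shift_def fun_eq_iff mult.left_commute split: nat.splits)
  ultimately obtain M' where M': "op_subgroup ?Op M'" "single 0 ` fvec b \<subseteq> M'"
      "op_noetherian ?Op M'"
    using op_noetherian_adjoin_finite[of "shift ` S" "range sc" "single 0 ` fvec b"] S(1) by blast
  \<comment> \<open>Starting from degree zero, closure of \<open>M'\<close> under the operators
    reaches every homogeneous element of the Rees module. Shifts by the generators \<open>S\<close>
    of \<open>m\<close> suffice, since the multipliers into a submodule form an ideal.\<close>
  have single_M': "single n v \<in> M'" if "v \<in> ?F n" for n v
    using that
  proof (induction n arbitrary: v)
    case 0
    then show ?case using M'(2) ideal_smult_UNIV[OF is_submod_fvec] by auto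
  next
    case (Suc n)
    let ?T = "{v. single (Suc n) v \<in> M'}"
    have T: "is_submod ?T"
    proof (rule is_submodI)
      have "single (Suc n) 0 = 0" by (auto simp: single_def)
      then show "0 \<in> ?T" using op_subgroupD(1)[OF M'(1)] by simp
      show "x + y \<in> ?T" if "x \<in> ?T" "y \<in> ?T" for x y
        using op_subgroupD(2)[OF M'(1)] that by (simp add: single_add)
      show "scl r x \<in> ?T" if "x \<in> ?T" for r x
        using op_subgroupD(5)[OF M'(1), of "sc r" "single (Suc n) x"] that by (simp add: sc_single)
    qed
    have "ideal_smult m (?F n) \<subseteq> ?T"
    proof (rule ideal_smult_subset[OF T])
      fix a v assume a: "a \<in> m" and v: "v \<in> ?F n"
      have "S \<subseteq> {x. scl x v \<in> ?T}"
        using op_subgroupD(5)[OF M'(1) _ Suc.IH[OF v]] by (auto simp flip: shift_single)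
      then show "scl a v \<in> ?T"
        using ideal_gen_subset[OF is_ideal_colon[OF T, of v]] a S(2) by blast
    qed
    then show ?case using Suc.prems ideal_smult_pow_Suc(1)[of m n "fvec b"] by blast
  qed
  \<comment> \<open>\<open>G j n\<close> is the degree \<open>n\<close> component of the submodule
    generated by the components of \<open>L\<close> in degrees up to \<open>j\<close>;
    \<open>K j\<close> collects the sequences in \<open>M'\<close> with such components.\<close>
  define G where
    "G j n = (if n \<le> j then ?F n \<inter> L else ideal_smult (ideal_pow m (n - j)) (?F j \<inter> L))" for j n
  define K where "K j = {w \<in> M'. \<forall>n. w n \<in> G j n}" for j
  have G: "is_submod (G j n)" for j n
  proof (cases "n \<le> j")
    case True
    have "is_submod (?F n \<inter> L)"
      using op_subgroup_Int is_submod_ideal_smult L unfolding is_submod_iff by blast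
    then show ?thesis using True by (simp only: G_def if_True)
  next
    case False
    then show ?thesis by (simp only: G_def if_False is_submod_ideal_smult)
  qed
  have F_Suc: "scl a v \<in> ?F (Suc n)" if "a \<in> m" "v \<in> ?F n" for a v n
    using that ideal_pow_mult[OF ideal_pow_1[OF that(1)], of _ n] unfolding ideal_smult_fvec
    by (auto simp: fvec_def simp del: ideal_pow.simps)
  \<comment> \<open>This gives closure under shifts. At \<open>n = j\<close> the two clauses of
    \<open>G\<close> meet; beyond it the factor \<open>a\<close> is absorbed into the power of
    \<open>m\<close>.\<close>
  have G_Suc: "scl a v \<in> G j (Suc n)" if a: "a \<in> m" and v: "v \<in> G j n" for a v j n
  proof -
    consider "Suc n \<le> j" | "n = j" | "n > j" by linarith
    then show ?thesis
    proof cases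
      case 1
      then show ?thesis using v F_Suc[OF a] is_submodD(5)[OF L] unfolding G_def by auto
    next
      case 2
      then show ?thesis using v ideal_smult_memI[OF ideal_pow_1[OF a]] unfolding G_def by simp
    next
      case 3
      have "ideal_smult (ideal_pow m (n - j)) (?F j \<inter> L) \<subseteq> {v. scl a v \<in> G j (Suc n)}"
      proof (rule ideal_smult_subset)
        show "is_submod {v. scl a v \<in> G j (Suc n)}"
        proof (rule is_submodI)
          have "scl a 0 = 0" by auto
          then show "0 \<in> {v. scl a v \<in> G j (Suc n)}" using is_submodD(1)[OF G] by simp
          show "x + y \<in> {v. scl a v \<in> G j (Suc n)}"
            if "x \<in> {v. scl a v \<in> G j (Suc n)}" "y \<in> {v. scl a v \<in> G j (Suc n)}" for x y
            using that is_submodD(2)[OF G] by (simp add: scl_add)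
          show "scl r x \<in> {v. scl a v \<in> G j (Suc n)}" if "x \<in> {v. scl a v \<in> G j (Suc n)}" for r x
            using that is_submodD(5)[OF G, of "scl a x" j "Suc n" r]
            by (simp add: scl_scl mult.commute)
        qed
        fix c u assume "c \<in> ideal_pow m (n - j)" "u \<in> ?F j \<inter> L"
        moreover have "Suc (n - j) = Suc n - j" using 3 by simp
        ultimately show "scl c u \<in> {v. scl a v \<in> G j (Suc n)}"
          using 3 ideal_pow_mult[OF ideal_pow_1[OF a], of c "n - j"]
            ideal_smult_memI[of "a * c" "ideal_pow m (Suc n - j)" u "?F j \<inter> L"]
          by (simp add: G_def scl_scl del: ideal_pow.simps)
      qed
      then show ?thesis using v 3 unfolding G_def by auto
    qed
  qed
  have "op_subgroup ?Op (K j)" for j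
  proof (rule op_subgroupI)
    show "0 \<in> K j" using op_subgroupD(1)[OF M'(1)] is_submodD(1)[OF G] by (simp add: K_def)
    show "x + y \<in> K j" if "x \<in> K j" "y \<in> K j" for x y
      using that op_subgroupD(2)[OF M'(1)] is_submodD(2)[OF G] by (simp add: K_def)
    show "- x \<in> K j" if "x \<in> K j" for x
      using that op_subgroupD(3)[OF M'(1)] is_submodD(3)[OF G] by (simp add: K_def)
    show "f x \<in> K j" if f: "f \<in> ?Op" and x: "x \<in> K j" for f x
    proof -
      have "f x n \<in> G j n" for n
        using f
      proof
        assume "f \<in> range sc"
        then show ?thesis using x is_submodD(5)[OF G] by (auto simp: sc_def K_def)
      next
        assume "f \<in> shift ` S"
        then show ?thesis
          using x G_Suc is_submodD(1)[OF G] S(2) ideal_gen_superset[of S]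
          by (auto simp: shift_def K_def split: nat.split)
      qed
      then show ?thesis using op_subgroupD(5)[OF M'(1) f] x by (simp add: K_def)
    qed
  qed
  moreover have "K j \<subseteq> K (Suc j)" for j
  proof -
    have "G j n \<subseteq> G (Suc j) n" for n
    proof (cases "n \<le> j")
      case False
      \<comment> \<open>One factor of \<open>m\<close> moves from the coefficients to the module,
        where it carries m^j F \<inter> L into m^(j+1) F \<inter> L.\<close>
      have "n - j = Suc (n - Suc j)" using False by simp
      then have "G j n \<subseteq> ideal_smult (ideal_pow m (n - Suc j)) (ideal_smult m (?F j \<inter> L))"
        using False ideal_smult_pow_Suc(2)[of m "n - Suc j" "?F j \<inter> L"]
        by (simp add: G_def del: ideal_pow.simps)
      also have "\<dots> \<subseteq> ideal_smult (ideal_pow m (n - Suc j)) (?F (Suc j) \<inter> L)"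
      proof (rule ideal_smult_mono[OF order_refl ideal_smult_subset])
        show "is_submod (?F (Suc j) \<inter> L)" using G[of "Suc j" "Suc j"] by (simp add: G_def)
        show "scl a v \<in> ?F (Suc j) \<inter> L" if "a \<in> m" "v \<in> ?F j \<inter> L" for a v
          using that F_Suc is_submodD(5)[OF L] by blast
      qed
      also have "\<dots> \<subseteq> G (Suc j) n"
      proof (cases "n = Suc j")
        case True
        have "is_submod (?F (Suc j) \<inter> L)" using G[of "Suc j" "Suc j"] by (simp add: G_def)
        from ideal_smult_UNIV[OF this] True show ?thesis by (simp add: G_def)
      qed (use False in \<open>simp add: G_def\<close>)
      finally show ?thesis .
    qed (simp add: G_def)
    then show ?thesis unfolding K_def by blast
  qed
  ultimately obtain s where s: "\<And>i. i \<ge> s \<Longrightarrow> K i = K s"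
    using op_noetherianD[OF M'(3), of K] unfolding K_def by blast
  have "?F n \<inter> L = ideal_smult (ideal_pow m (n - s)) (?F s \<inter> L)" if n: "n \<ge> s" for n
  proof
    have Gs: "is_submod (?F n \<inter> L)" using G[of n n] by (simp add: G_def)
    show "?F n \<inter> L \<subseteq> ideal_smult (ideal_pow m (n - s)) (?F s \<inter> L)"
    proof
      fix v assume v: "v \<in> ?F n \<inter> L"
      \<comment> \<open>In \<open>K n\<close> the degree \<open>n\<close> component may be any
        element of m^n F \<inter> L; stationarity puts the same homogeneous element into
        \<open>K s\<close>, where that component is restricted to the right-hand side.\<close>
      then have "single n v \<in> K n"
        using single_M'[of v n] is_submodD(1)[OF G] v G_def[of n n] by (simp add: K_def single_def)
      then have "single n v \<in> K s" using s[OF n] by simp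
      then have "single n v n \<in> G s n" unfolding K_def by blast
      then have "v \<in> G s n" by (simp add: single_def)
      then show "v \<in> ideal_smult (ideal_pow m (n - s)) (?F s \<inter> L)"
        using n ideal_smult_UNIV[OF Gs] by (cases "n = s") (auto simp: G_def)
    qed
    show "ideal_smult (ideal_pow m (n - s)) (?F s \<inter> L) \<subseteq> ?F n \<inter> L"
    proof (rule ideal_smult_subset[OF Gs])
      fix a v assume "a \<in> ideal_pow m (n - s)" "v \<in> ?F s \<inter> L"
      then show "scl a v \<in> ?F n \<inter> L"
        using ideal_pow_mult[of a m "n - s" _ s] n is_submodD(5)[OF L]
        unfolding ideal_smult_fvec by (auto simp: fvec_def)
    qed
  qed
  then show ?thesis by blast
qed

section \<open>Units in local rings and Nakayama's lemma\<close>

lemma local_ring_unit: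
  assumes "local_ring m" "u \<notin> m"
  obtains w where "w * u = 1"
proof -
  have "is_ideal (range (\<lambda>w. w * u))"
  proof (rule is_idealI)
    show "0 \<in> range (\<lambda>w. w * u)" by (rule range_eqI[of _ _ 0]) simp
    show "x + y \<in> range (\<lambda>w. w * u)" if "x \<in> range (\<lambda>w. w * u)" "y \<in> range (\<lambda>w. w * u)" for x y
      using that by (auto simp flip: distrib_right)
    show "r * x \<in> range (\<lambda>w. w * u)" if "x \<in> range (\<lambda>w. w * u)" for r x
      using that by (auto simp flip: mult.assoc)
  qed
  moreover have "u \<in> range (\<lambda>w. w * u)" by (rule range_eqI[of _ _ 1]) simp
  ultimately have "range (\<lambda>w. w * u) = UNIV"
    using assms unfolding local_ring_def by blast
  then show ?thesis using that by (metis UNIV_I imageE)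
qed

lemma local_ring_one_minus:
  assumes "local_ring m" "a \<in> m"
  obtains w where "w * (1 - a) = 1"
proof -
  have m: "is_ideal m" "m \<noteq> UNIV" using assms(1) by (auto simp: local_ring_def)
  have "1 - a \<notin> m"
  proof
    assume "1 - a \<in> m"
    then have "1 \<in> m" using is_idealD(2)[OF m(1) _ assms(2), of "1 - a"] by simp
    then have "x \<in> m" for x using is_idealD(5)[OF m(1), of 1 x] by simp
    then show False using m(2) by blast
  qed
  then show ?thesis using local_ring_unit[OF assms(1)] that by blast
qed

text \<open>If \<open>L \<noteq> K\<close>, the ascending chain condition yields a maximal proper submodule \<open>P\<close> of \<open>K\<close>
  containing \<open>L\<close>, and \<open>m K \<subseteq> P\<close> because \<open>K / P\<close> is simple.\<close>

lemma Nakayama: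
  fixes m :: "'a::comm_ring_1 set"
  assumes noeth: "noetherian_ring TYPE('a)" and loc: "local_ring m"
    and L: "is_submod L" and K: "is_submod K" "K \<subseteq> fvec b" and LK: "L \<subseteq> K"
    and K_le: "\<And>v. v \<in> K \<Longrightarrow> \<exists>u\<in>L. v - u \<in> ideal_smult m K"
  shows "L = K"
proof (rule ccontr)
  assume ne: "L \<noteq> K"
  have m: "is_ideal m" using loc by (simp add: local_ring_def)
  let ?P = "\<lambda>P. is_submod P \<and> L \<subseteq> P \<and> P \<subset> K"
  have "\<exists>P. ?P P \<and> (\<forall>P'. ?P P' \<longrightarrow> P \<subseteq> P' \<longrightarrow> P' = P)"
  proof (rule ccontr)
    assume "\<nexists>P. ?P P \<and> (\<forall>P'. ?P P' \<longrightarrow> P \<subseteq> P' \<longrightarrow> P' = P)"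
    then have step: "\<exists>P'. ?P P' \<and> P \<subset> P'" if "?P P" for P using that by (metis psubsetI)
    have "?P L" using L LK ne by blast
    \<comment> \<open>Without a maximal element, dependent choice would produce a strictly
      increasing chain of submodules of R^b.\<close>
    then have "\<exists>f :: nat \<Rightarrow> (nat \<Rightarrow> 'a) set. \<forall>i. ?P (f i) \<and> f i \<subset> f (Suc i)"
      by (intro dependent_nat_choice[of "\<lambda>_. ?P" "\<lambda>_ P P'. P \<subset> P'"]) (blast, rule step)
    then obtain f :: "nat \<Rightarrow> (nat \<Rightarrow> 'a) set" where f: "\<And>i. ?P (f i)" "\<And>i. f i \<subset> f (Suc i)"
      by metis
    have sub: "op_subgroup (range scl) (f i)" for i
      using f(1)[of i] by (simp only: is_submod_iff)
    have le: "f i \<subseteq> fvec b" "f i \<subseteq> f (Suc i)" for i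
      using f(1)[of i] f(2)[of i] K(2) by blast+
    show False
    proof (rule op_noetherianD[of "range scl" "fvec b" f, OF op_noetherian_fvec[OF noeth] sub le])
      fix n assume "\<And>i. i \<ge> n \<Longrightarrow> f i = f n"
      from this[of "Suc n"] f(2)[of n] show False by simp
    qed
  qed
  then obtain P where P: "is_submod P" "L \<subseteq> P" "P \<subset> K"
    and Pmax: "\<And>P'. ?P P' \<Longrightarrow> P \<subseteq> P' \<Longrightarrow> P' = P" by blast
  have adj: "is_submod {p + scl r x |p r. p \<in> P \<and> r \<in> A}" if A: "is_ideal A" for A x
  proof (rule is_submodI)
    have "0 = 0 + scl 0 x" by auto
    then show "0 \<in> {p + scl r x |p r. p \<in> P \<and> r \<in> A}"
      using is_submodD(1)[OF P(1)] is_idealD(1)[OF A] by blast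
    fix y assume "y \<in> {p + scl r x |p r. p \<in> P \<and> r \<in> A}"
    then obtain p r where y: "y = p + scl r x" "p \<in> P" "r \<in> A" by blast
    { fix z assume "z \<in> {p + scl r x |p r. p \<in> P \<and> r \<in> A}"
      then obtain q t where z: "z = q + scl t x" "q \<in> P" "t \<in> A" by blast
      have "y + z = (p + q) + scl (r + t) x" by (auto simp: y z fun_eq_iff algebra_simps)
      then show "y + z \<in> {p + scl r x |p r. p \<in> P \<and> r \<in> A}"
        using is_submodD(2)[OF P(1) y(2) z(2)] is_idealD(2)[OF A y(3) z(3)] by blast }
    fix t
    have "scl t y = scl t p + scl (t * r) x" by (simp add: y scl_add scl_scl)
    then show "scl t y \<in> {p + scl r x |p r. p \<in> P \<and> r \<in> A}"
      using is_submodD(5)[OF P(1) y(2)] is_idealD(5)[OF A y(3)] by blast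
  qed
  have adj_K: "{p + scl r x |p r. p \<in> P \<and> r \<in> A} \<subseteq> K" if "x \<in> K" for A x
    using that is_submodD(2,5)[OF K(1)] P(3) by blast
  have adj_P: "P \<subseteq> {p + scl r x |p r. p \<in> P \<and> r \<in> A}" if A: "is_ideal A" for A x
  proof
    fix p assume "p \<in> P"
    moreover have "p = p + scl 0 x" by auto
    ultimately show "p \<in> {p + scl r x |p r. p \<in> P \<and> r \<in> A}" using is_idealD(1)[OF A] by blast
  qed
  have "scl a x \<in> P" if a: "a \<in> m" and x: "x \<in> K" for a x
  proof (rule ccontr)
    assume ax: "scl a x \<notin> P"
    \<comment> \<open>By maximality P + m x is all of \<open>K\<close>, hence x = p + r x with
      \<open>r\<close> in \<open>m\<close>. Since 1 - r is a unit, \<open>x\<close> and with it a x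
      lies in \<open>P\<close>.\<close>
    let ?Q = "{p + scl r x |p r. p \<in> P \<and> r \<in> m}"
    have "scl a x = 0 + scl a x" by simp
    then have "scl a x \<in> ?Q" using is_submodD(1)[OF P(1)] a by blast
    then have "?Q = K"
      using Pmax[of ?Q] ax adj[OF m] adj_K[OF x, of m] adj_P[OF m] P(2) by blast
    then obtain p r where p: "x = p + scl r x" "p \<in> P" "r \<in> m" using x by blast
    obtain w where w: "w * (1 - r) = 1" using local_ring_one_minus[OF loc p(3)] .
    have "w * p j = x j" for j
    proof -
      have "p j = (1 - r) * x j" using fun_cong[OF p(1), of j]
        by (simp add: left_diff_distrib eq_diff_eq)
      then have "w * p j = w * (1 - r) * x j" by (simp only: mult.assoc)
      then show ?thesis by (simp only: w mult_1)
    qed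
    then have "scl w p = x" by auto
    then have "x \<in> P" using is_submodD(5)[OF P(1) p(2)] by metis
    then show False using ax is_submodD(5)[OF P(1)] by blast
  qed
  then have "ideal_smult m K \<subseteq> P" using ideal_smult_subset[OF P(1)] by blast
  moreover obtain v where v: "v \<in> K" "v \<notin> P" using P(3) by blast
  ultimately obtain u where "u \<in> L" "v - u \<in> P" using K_le[OF v(1)] by blast
  then have "(v - u) + u \<in> P" using is_submodD(2)[OF P(1)] P(2) by blast
  then show False using v by simp
qed

section \<open>Matrices and filtered free modules\<close>

abbreviation (input) fpow :: "'a::comm_ring_1 set \<Rightarrow> nat \<Rightarrow> nat \<Rightarrow> (nat \<Rightarrow> 'a) set" where
  "fpow m b n \<equiv> ideal_smult (ideal_pow m n) (fvec b)"

lemma fpow_iff: "v \<in> fpow m b n \<longleftrightarrow> v \<in> fvec b \<and> (\<forall>j. v j \<in> ideal_pow m n)"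
  by (simp add: ideal_smult_fvec)

lemma fpow_antimono: "i \<le> j \<Longrightarrow> fpow m b j \<subseteq> fpow m b i"
  by (rule ideal_smult_mono[OF ideal_pow_antimono order_refl])

lemma fpow_0: "fpow m b 0 = fvec b"
  by (simp add: ideal_smult_UNIV[OF is_submod_fvec])

lemma fpow_subset_fvec: "fpow m b n \<subseteq> fvec b"
  using fpow_antimono[of 0 n m b] fpow_0[of m b] by simp

lemma scl_fpow: "a \<in> ideal_pow m i \<Longrightarrow> v \<in> fpow m b j \<Longrightarrow> scl a v \<in> fpow m b (i + j)"
  using ideal_pow_mult[of a m i _ j] unfolding fpow_iff by (simp add: fvec_def)

lemma mapply_plus: "mapply A bo bi (u + v) = mapply A bo bi u + mapply A bo bi v"
  by (auto simp: mapply_def fun_eq_iff distrib_left sum.distrib)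

lemma mapply_scl: "mapply A bo bi (scl r v) = scl r (mapply A bo bi v)"
  by (auto simp: mapply_def fun_eq_iff sum_distrib_left mult.left_commute)

lemma mapply_0: "mapply A bo bi 0 = 0"
  by (auto simp: mapply_def fun_eq_iff)

lemma mapply_diff: "mapply A bo bi (u - v) = mapply A bo bi u - mapply A bo bi v"
  by (auto simp: mapply_def fun_eq_iff right_diff_distrib sum_subtractf)

lemma mapply_matrix_plus:
  "mapply (\<lambda>r c. A r c + B r c) bo bi v = mapply A bo bi v + mapply B bo bi v"
  by (auto simp: mapply_def fun_eq_iff distrib_right sum.distrib)

lemma mapply_in_fvec: "mapply A bo bi v \<in> fvec bo"
  by (auto simp: mapply_def fvec_def)

lemma mapply_fpow:
  assumes "\<forall>r<bo. \<forall>c<bi. A r c \<in> ideal_pow m k" and "v \<in> fpow m bi n"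
  shows "mapply A bo bi v \<in> fpow m bo (k + n)"
proof -
  have "(\<Sum>c<bi. A r c * v c) \<in> ideal_pow m (k + n)" if "r < bo" for r
    by (rule is_ideal_sum[OF is_ideal_ideal_pow], rule ideal_pow_mult)
      (use assms that in \<open>auto simp: fpow_iff\<close>)
  then show ?thesis
    unfolding fpow_iff using mapply_in_fvec[of A bo bi v] is_idealD(1)[OF is_ideal_ideal_pow]
    by (auto simp: mapply_def)
qed

lemma is_submod_mapply_image:
  assumes "is_submod P" shows "is_submod (mapply A bo bi ` P)"
proof (rule is_submodI)
  show "0 \<in> mapply A bo bi ` P"
    using imageI[OF is_submodD(1)[OF assms], of "mapply A bo bi"] by (simp only: mapply_0)
  fix x assume "x \<in> mapply A bo bi ` P"
  then obtain u where u: "x = mapply A bo bi u" "u \<in> P" by blast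
  show "x + y \<in> mapply A bo bi ` P" if y: "y \<in> mapply A bo bi ` P" for y
  proof -
    obtain v where v: "y = mapply A bo bi v" "v \<in> P" using y by blast
    show ?thesis
      unfolding u(1) v(1) mapply_plus[symmetric] by (rule imageI[OF is_submodD(2)[OF assms u(2) v(2)]])
  qed
  show "scl r x \<in> mapply A bo bi ` P" for r
    unfolding u(1) mapply_scl[symmetric] by (rule imageI[OF is_submodD(5)[OF assms u(2)]])
qed

lemma is_submod_mimage: "is_submod (mimage A bo bi)"
  unfolding mimage_def by (rule is_submod_mapply_image[OF is_submod_fvec])

lemma mkernel_iff: "v \<in> mkernel A bo bi \<longleftrightarrow> v \<in> fvec bi \<and> mapply A bo bi v = 0"
  by (simp add: mkernel_def zero_fun_def)

lemma is_submod_mkernel: "is_submod (mkernel A bo bi)"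
proof (rule is_submodI)
  note D = is_submodD[OF is_submod_fvec]
  show "0 \<in> mkernel A bo bi" using D(1) by (simp add: mkernel_iff mapply_0)
  show "x + y \<in> mkernel A bo bi" if "x \<in> mkernel A bo bi" "y \<in> mkernel A bo bi" for x y
    using that D(2)[of x bi y] by (simp add: mkernel_iff mapply_plus)
  have "scl r 0 = 0" for r :: 'a by auto
  then show "scl r x \<in> mkernel A bo bi" if "x \<in> mkernel A bo bi" for r x
    using that D(5)[of x bi r] by (simp add: mkernel_iff mapply_scl)
qed

lemma mkernel_subset_fvec: "mkernel A bo bi \<subseteq> fvec bi"
  by (auto simp: mkernel_def)

definition mcol :: "(nat \<Rightarrow> nat \<Rightarrow> 'a::comm_ring_1) \<Rightarrow> nat \<Rightarrow> nat \<Rightarrow> nat \<Rightarrow> 'a" where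
  "mcol A bo c = (\<lambda>r. if r < bo then A r c else 0)"

lemma mcol_in_mimage:
  assumes "c < bi" shows "mcol A bo c \<in> mimage A bo bi"
proof -
  have "(\<Sum>k<bi. A r k * (if k = c then 1 else 0)) = A r c" for r
    using assms by (simp add: if_distrib[of "\<lambda>x. A r _ * x"] cong: if_cong)
  then have "mcol A bo c = mapply A bo bi (\<lambda>k. if k = c then 1 else 0)"
    by (auto simp: mcol_def mapply_def)
  moreover have "(\<lambda>k. if k = c then 1 else 0) \<in> fvec bi" using assms by (auto simp: fvec_def)
  ultimately show ?thesis unfolding mimage_def by blast
qed

lemma mimage_subset:
  assumes K: "is_submod K" and col: "\<And>c. c < bi \<Longrightarrow> mcol A bo c \<in> K"
  shows "mimage A bo bi \<subseteq> K"
  unfolding mimage_def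
proof clarify
  fix v
  \<comment> \<open>Cutting the matrix down to its first \<open>k\<close> columns yields the partial
    sums of a linear combination of columns.\<close>
  have "mapply A bo k v \<in> K" if "k \<le> bi" for k
    using that
  proof (induction k)
    case 0
    have "mapply A bo 0 v = 0" by (auto simp: mapply_def)
    then show ?case using is_submodD(1)[OF K] by (simp only:)
  next
    case (Suc k)
    have "mapply A bo (Suc k) v = mapply A bo k v + scl (v k) (mcol A bo k)"
      by (auto simp: mapply_def mcol_def fun_eq_iff mult.commute)
    moreover have "mapply A bo k v \<in> K" "mcol A bo k \<in> K" using Suc col[of k] by simp_all
    ultimately show ?case using is_submodD(2)[OF K _ is_submodD(5)[OF K]] by (simp only:)
  qed
  then show "mapply A bo bi v \<in> K" by simp
qed

section \<open>Comparison of initial modules\<close>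

text \<open>\<open>init_le m b L L'\<close> expresses the inclusion of the initial modules of \<open>L\<close> and \<open>L'\<close> in the
  associated graded module of \<open>R\<^sup>b\<close>.\<close>

definition init_le ::
    "'a::comm_ring_1 set \<Rightarrow> nat \<Rightarrow> (nat \<Rightarrow> 'a) set \<Rightarrow> (nat \<Rightarrow> 'a) set \<Rightarrow> bool" where
  "init_le m b L L' \<longleftrightarrow> (\<forall>n. \<forall>y \<in> L \<inter> fpow m b n. \<exists>y'\<in>L'. y - y' \<in> fpow m b (Suc n))"

text \<open>The approximant also lies in m^n F, because it differs from \<open>y\<close> by an
  element of m^(n+1) F.\<close>

lemma init_leD:
  assumes "init_le m b L L'" "y \<in> L" "y \<in> fpow m b n"
  obtains y' where "y' \<in> L'" "y' \<in> fpow m b n" "y - y' \<in> fpow m b (Suc n)"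
proof -
  obtain y' where y': "y' \<in> L'" "y - y' \<in> fpow m b (Suc n)"
    using assms unfolding init_le_def by blast
  then have "y - (y - y') \<in> fpow m b n"
    using assms(3) fpow_antimono[of n "Suc n" m b] is_submodD(4)[OF is_submod_ideal_smult] by fastforce
  then show ?thesis using that y' by simp
qed

lemma init_leI:
  assumes "\<And>n y. y \<in> L \<Longrightarrow> y \<in> fpow m b n \<Longrightarrow> \<exists>y'\<in>L'. y - y' \<in> fpow m b (Suc n)"
  shows "init_le m b L L'"
  using assms unfolding init_le_def by blast

lemma init_le_trans:
  assumes "init_le m b L L'" "init_le m b L' L''"
  shows "init_le m b L L''"
proof (rule init_leI)
  fix n y assume "y \<in> L" "y \<in> fpow m b n"
  then obtain y' where y': "y' \<in> L'" "y' \<in> fpow m b n" "y - y' \<in> fpow m b (Suc n)"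
    using init_leD[OF assms(1)] by blast
  then obtain y'' where y'': "y'' \<in> L''" "y' - y'' \<in> fpow m b (Suc n)"
    using init_leD[OF assms(2)] by blast
  have "(y - y') + (y' - y'') \<in> fpow m b (Suc n)"
    using y' y'' is_submodD(2)[OF is_submod_ideal_smult] by blast
  then show "\<exists>y''\<in>L''. y - y'' \<in> fpow m b (Suc n)" using y'' by auto
qed

lemma init_le_initial_piece:
  assumes "init_le m b L L'"
  shows "initial_piece m (fvec b) L n \<subseteq> initial_piece m (fvec b) L' n"
proof
  fix x assume "x \<in> initial_piece m (fvec b) L n"
  then obtain y z where x: "x = y + z" "y \<in> L" "y \<in> fpow m b n" "z \<in> fpow m b (Suc n)"
    unfolding initial_piece_def vsum_def plus_fun_def by blast
  then obtain y' where y': "y' \<in> L'" "y' \<in> fpow m b n" "y - y' \<in> fpow m b (Suc n)"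
    using init_leD[OF assms] by blast
  have "x = y' + ((y - y') + z)" by (simp add: x)
  then have "x = (\<lambda>j. y' j + ((y - y') + z) j)" by (simp only: plus_fun_def)
  moreover have "(y - y') + z \<in> fpow m b (Suc n)"
    using y' x is_submodD(2)[OF is_submod_ideal_smult] by blast
  ultimately show "x \<in> initial_piece m (fvec b) L' n"
    using y' unfolding initial_piece_def vsum_def by blast
qed

lemma init_le_antisym:
  "init_le m b L L' \<Longrightarrow> init_le m b L' L \<Longrightarrow>
    initial_module m (fvec b) L = initial_module m (fvec b) L'"
  unfolding initial_module_def using init_le_initial_piece by blast

section \<open>Perturbing one differential\<close>

locale noetherian_local =
  fixes m :: "'a::comm_ring_1 set"
  assumes noeth: "noetherian_ring TYPE('a)" and loc: "local_ring m"
begin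

lemma is_ideal_m: "is_ideal m"
  using loc by (simp add: local_ring_def)

text \<open>\<open>AR\<close> is a \<open>LEAST\<close>; \<open>Artin_Rees\<close> provides the
  existence by which the least index satisfies its defining equations.\<close>

lemma AR_property:
  assumes "is_submod L" "n \<ge> AR m L (fvec b)"
  shows "fpow m b n \<inter> L
    = ideal_smult (ideal_pow m (n - AR m L (fvec b))) (fpow m b (AR m L (fvec b)) \<inter> L)"
  using LeastI_ex[OF Artin_Rees[OF noeth is_ideal_m assms(1), of b]] assms(2)
  unfolding AR_def by blast

text \<open>The form in which the Artin--Rees number s is used: an element of the image in m^n F is
  a combination of images with coefficients in m^(n-s), and these coefficients pass to the
  preimages.\<close>

lemma AR_lift:
  assumes y: "y \<in> mimage A bo bi" "y \<in> fpow m bo n" and n: "n \<ge> AR m (mimage A bo bi) (fvec bo)"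
  obtains u where "u \<in> fpow m bi (n - AR m (mimage A bo bi) (fvec bo))" "mapply A bo bi u = y"
proof -
  let ?s = "AR m (mimage A bo bi) (fvec bo)"
  have "ideal_smult (ideal_pow m (n - ?s)) (fpow m bo ?s \<inter> mimage A bo bi)
      \<subseteq> mapply A bo bi ` fpow m bi (n - ?s)"
  proof (rule ideal_smult_subset[OF is_submod_mapply_image[OF is_submod_ideal_smult]])
    fix a v assume a: "a \<in> ideal_pow m (n - ?s)" and "v \<in> fpow m bo ?s \<inter> mimage A bo bi"
    then obtain w where w: "v = mapply A bo bi w" "w \<in> fvec bi" unfolding mimage_def by blast
    have "scl a w \<in> fpow m bi (n - ?s)" using a w(2) by (rule ideal_smult_memI)
    then show "scl a v \<in> mapply A bo bi ` fpow m bi (n - ?s)"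
      unfolding w(1) mapply_scl[symmetric] by (rule imageI)
  qed
  then show ?thesis using AR_property[OF is_submod_mimage n] y that by blast
qed

text \<open>Successive approximation makes \<open>v\<close> congruent modulo \<open>L\<close> to
  elements of \<open>K\<close> of arbitrarily high order; above the Artin--Rees number of
  \<open>K\<close> these lie in m K, and Nakayama's lemma applies.\<close>

lemma eq_if_init_le:
  assumes L: "is_submod L" and K: "is_submod K" "K \<subseteq> fvec b" and LK: "L \<subseteq> K"
    and init: "init_le m b K L"
  shows "L = K"
proof (rule Nakayama[OF noeth loc L K LK])
  fix v assume v: "v \<in> K"
  have approx: "\<exists>u\<in>L. v - u \<in> K \<inter> fpow m b n" for n
  proof (induction n)
    case 0
    have "v - 0 \<in> K \<inter> fpow m b 0" unfolding fpow_0 using v K by auto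
    then show ?case using is_submodD(1)[OF L] by blast
  next
    case (Suc n)
    then obtain u where u: "u \<in> L" "v - u \<in> K" "v - u \<in> fpow m b n" by blast
    then obtain w where w: "w \<in> L" "(v - u) - w \<in> fpow m b (Suc n)"
      using init_leD[OF init] by blast
    have "(v - u) - w \<in> K" using u w LK is_submodD(4)[OF K(1)] by blast
    then have "v - (u + w) \<in> K \<inter> fpow m b (Suc n)" using w by (simp add: diff_diff_eq)
    then show ?case using is_submodD(2)[OF L u(1) w(1)] by blast
  qed
  \<comment> \<open>\<open>Suc ?s\<close> is the least exponent for which the Artin--Rees equality
    leaves a factor of \<open>m\<close>.\<close>
  let ?s = "AR m K (fvec b)"
  have "ideal_pow m (Suc 0) \<subseteq> m"
    unfolding ideal_pow.simps
    by (rule ideal_gen_subset[OF is_ideal_m]) (auto intro: is_idealD(6)[OF is_ideal_m])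
  then have "fpow m b (Suc ?s) \<inter> K \<subseteq> ideal_smult m K"
    using AR_property[OF K(1), of b "Suc ?s"] ideal_smult_mono[of "ideal_pow m (Suc 0)" m _ K]
    by (simp del: ideal_pow.simps)
  then show "\<exists>u\<in>L. v - u \<in> ideal_smult m K" using approx[of "Suc ?s"] by blast
qed

text \<open>Let s be the Artin--Rees number of the image of \<open>A\<close>. An element of order n
  in this image is A u with \<open>u\<close> of order n - s, and N > s puts E u in order above n. So
  the initial module of im A lies in that of im B, hence in that of \<open>K\<close>; by
  \<open>init\<close> all three agree.\<close>

lemma perturb_image:
  fixes A E :: "nat \<Rightarrow> nat \<Rightarrow> 'a" and bo bi :: nat
  defines "B \<equiv> \<lambda>r c. A r c + E r c"
  assumes E: "\<forall>r<bo. \<forall>c<bi. E r c \<in> ideal_pow m N"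
    and N: "AR m (mimage A bo bi) (fvec bo) < N"
    and K: "is_submod K" "K \<subseteq> fvec bo" "mimage B bo bi \<subseteq> K"
    and init: "init_le m bo K (mimage A bo bi)"
  shows "mimage B bo bi = K" "init_le m bo (mimage A bo bi) K"
proof -
  let ?s = "AR m (mimage A bo bi) (fvec bo)"
  have AB: "init_le m bo (mimage A bo bi) (mimage B bo bi)"
  proof (rule init_leI)
    fix n y assume y: "y \<in> mimage A bo bi" "y \<in> fpow m bo n"
    \<comment> \<open>For n < s the truncated difference \<open>n - ?s\<close> is 0 and any preimage
      serves; there N > s > n still bounds the order of E u.\<close>
    obtain u where u: "u \<in> fpow m bi (n - ?s)" "mapply A bo bi u = y"
    proof (cases "n \<ge> ?s")
      case True
      then show ?thesis using AR_lift[OF y] that by blast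
    next
      case False
      moreover obtain u where "u \<in> fvec bi" "mapply A bo bi u = y"
        using y(1) unfolding mimage_def by blast
      ultimately show ?thesis using that[of u] fpow_0[of m bi] by simp
    qed
    have "mapply E bo bi u \<in> fpow m bo (N + (n - ?s))" using mapply_fpow[OF E u(1)] .
    moreover have "Suc n \<le> N + (n - ?s)" using N by simp
    ultimately have "- mapply E bo bi u \<in> fpow m bo (Suc n)"
      using fpow_antimono is_submodD(3)[OF is_submod_ideal_smult] by blast
    moreover have "y - mapply B bo bi u = - mapply E bo bi u"
      unfolding B_def mapply_matrix_plus u(2) by simp
    moreover have "mapply B bo bi u \<in> mimage B bo bi"
      using u(1) fpow_subset_fvec unfolding mimage_def by blast
    ultimately show "\<exists>y'\<in>mimage B bo bi. y - y' \<in> fpow m bo (Suc n)" by metis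
  qed
  show "mimage B bo bi = K"
    using eq_if_init_le[OF is_submod_mimage K] init_le_trans[OF init AB] by blast
  then show "init_le m bo (mimage A bo bi) K" using AB by simp
qed

text \<open>Successive approximation transfers the lifting property from \<open>A\<close> to
  \<open>B\<close> with the same \<open>s\<close>. A remainder of order n + k agrees to the next
  order with some A w, where \<open>w\<close> has order n + k - s; adding \<open>w\<close> to the
  lift improves the remainder, since E w has order above n + k.\<close>

lemma perturb_lift:
  fixes A E :: "nat \<Rightarrow> nat \<Rightarrow> 'a" and bo bi :: nat
  defines "B \<equiv> \<lambda>r c. A r c + E r c" and "s \<equiv> AR m (mimage A bo bi) (fvec bo)"
  assumes E: "\<forall>r<bo. \<forall>c<bi. E r c \<in> ideal_pow m N" and N: "s < N"
    and init: "init_le m bo (mimage B bo bi) (mimage A bo bi)"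
    and y: "y \<in> mimage B bo bi" "y \<in> fpow m bo n" and n: "s \<le> n"
  obtains u where "u \<in> fpow m bi (n - s)" "mapply B bo bi u = y"
proof -
  have B_mem: "mapply B bo bi u \<in> mimage B bo bi" if "u \<in> fpow m bi k" for u k
    using that fpow_subset_fvec unfolding mimage_def by blast
  have approx: "\<exists>u\<in>fpow m bi (n - s). y - mapply B bo bi u \<in> fpow m bo (n + k)" for k
  proof (induction k)
    case 0
    have "y - mapply B bo bi 0 \<in> fpow m bo (n + 0)" using y(2) by (simp add: mapply_0)
    then show ?case using is_submodD(1)[OF is_submod_ideal_smult] by blast
  next
    case (Suc k)
    then obtain u where u: "u \<in> fpow m bi (n - s)" "y - mapply B bo bi u \<in> fpow m bo (n + k)" by blast
    have "y - mapply B bo bi u \<in> mimage B bo bi"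
      using is_submodD(4)[OF is_submod_mimage y(1) B_mem[OF u(1)]] .
    then obtain z where z: "z \<in> mimage A bo bi" "z \<in> fpow m bo (n + k)"
        "y - mapply B bo bi u - z \<in> fpow m bo (Suc (n + k))"
      using init_leD[OF init _ u(2)] by blast
    obtain w where w: "w \<in> fpow m bi (n + k - s)" "mapply A bo bi w = z"
      using AR_lift[OF z(1,2)] n unfolding s_def by auto
    have "mapply E bo bi w \<in> fpow m bo (N + (n + k - s))" using mapply_fpow[OF E w(1)] .
    moreover have "Suc (n + k) \<le> N + (n + k - s)" using N n by simp
    ultimately have Ew: "mapply E bo bi w \<in> fpow m bo (Suc (n + k))" using fpow_antimono by blast
    have "y - mapply B bo bi u - z - mapply E bo bi w \<in> fpow m bo (Suc (n + k))"
      using is_submodD(4)[OF is_submod_ideal_smult z(3) Ew] .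
    moreover have "y - mapply B bo bi (u + w) = y - mapply B bo bi u - z - mapply E bo bi w"
      unfolding mapply_plus[of B] w(2)[symmetric] unfolding B_def mapply_matrix_plus
      by (simp add: algebra_simps)
    ultimately have "y - mapply B bo bi (u + w) \<in> fpow m bo (n + Suc k)" by (simp only: add_Suc_right)
    moreover have "n - s \<le> n + k - s" by simp
    then have "w \<in> fpow m bi (n - s)" using w(1) fpow_antimono by blast
    then have "u + w \<in> fpow m bi (n - s)" using u(1) is_submodD(2)[OF is_submod_ideal_smult] by blast
    ultimately show ?case by blast
  qed
  \<comment> \<open>The approximation stops after finitely many steps: with t the Artin--Rees number
    of the image of \<open>B\<close> itself, a remainder of order n + t has an exact preimage of
    order n.\<close>
  let ?t = "AR m (mimage B bo bi) (fvec bo)"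
  obtain u where u: "u \<in> fpow m bi (n - s)" "y - mapply B bo bi u \<in> fpow m bo (n + ?t)"
    using approx by blast
  have "y - mapply B bo bi u \<in> mimage B bo bi"
    using is_submodD(4)[OF is_submod_mimage y(1) B_mem[OF u(1)]] .
  then obtain w where w: "w \<in> fpow m bi (n + ?t - ?t)" "mapply B bo bi w = y - mapply B bo bi u"
    by (rule AR_lift[OF _ u(2)]) simp
  have "n - s \<le> n + ?t - ?t" by simp
  then have "w \<in> fpow m bi (n - s)" using w(1) fpow_antimono by blast
  then have "u + w \<in> fpow m bi (n - s)" using u(1) is_submodD(2)[OF is_submod_ideal_smult] by blast
  moreover have "mapply B bo bi (u + w) = y" by (simp add: mapply_plus w(2))
  ultimately show ?thesis using that by blast
qed

text \<open>If (A + E) z = 0 and z has order n, then A z = - E z has order N + n, so A z = A u with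
  \<open>u\<close> of order N + n - s > n. Thus z - u is a syzygy of \<open>A\<close> congruent to z
  modulo m^(n+1).\<close>

lemma perturb_kernel:
  fixes A E :: "nat \<Rightarrow> nat \<Rightarrow> 'a" and bo bi :: nat
  assumes E: "\<forall>r<bo. \<forall>c<bi. E r c \<in> ideal_pow m N"
    and N: "AR m (mimage A bo bi) (fvec bo) < N"
  shows "init_le m bi (mkernel (\<lambda>r c. A r c + E r c) bo bi) (mkernel A bo bi)"
proof (rule init_leI)
  let ?s = "AR m (mimage A bo bi) (fvec bo)"
  fix n z assume "z \<in> mkernel (\<lambda>r c. A r c + E r c) bo bi" and z: "z \<in> fpow m bi n"
  then have zf: "z \<in> fvec bi" and "mapply A bo bi z + mapply E bo bi z = 0"
    by (auto simp: mkernel_iff mapply_matrix_plus)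
  then have Az: "mapply A bo bi z = - mapply E bo bi z" by (simp add: eq_neg_iff_add_eq_0)
  have "- mapply E bo bi z \<in> fpow m bo (N + n)"
    using mapply_fpow[OF E z] is_submodD(3)[OF is_submod_ideal_smult] by blast
  then have "mapply A bo bi z \<in> fpow m bo (N + n)" by (simp only: Az)
  moreover have "mapply A bo bi z \<in> mimage A bo bi" using zf unfolding mimage_def by blast
  ultimately obtain u where u: "u \<in> fpow m bi (N + n - ?s)" "mapply A bo bi u = mapply A bo bi z"
    using AR_lift[of "mapply A bo bi z" A bo bi "N + n"] N by auto
  have "Suc n \<le> N + n - ?s" using N by simp
  then have "z - (z - u) \<in> fpow m bi (Suc n)" using u(1) fpow_antimono by fastforce
  moreover have "z - u \<in> fvec bi"
    using zf u(1) fpow_subset_fvec is_submodD(4)[OF is_submod_fvec] by blast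
  then have "z - u \<in> mkernel A bo bi" by (simp add: mkernel_iff mapply_diff u(2))
  ultimately show "\<exists>y'\<in>mkernel A bo bi. z - y' \<in> fpow m bi (Suc n)" by blast
qed

text \<open>The columns of \<open>C\<close> are syzygies of \<open>A\<close>, so \<open>B\<close>
  and \<open>E\<close> agree on them, with values in m^N. Lifting these values along
  \<open>B\<close> gives corrections in m^(N-s); this loss, added up over the steps, is the source
  of the sum of the s_i in the bound on the exponent.\<close>

lemma perturb_step:
  fixes A E C :: "nat \<Rightarrow> nat \<Rightarrow> 'a" and bo bi :: nat
  defines "B \<equiv> \<lambda>r c. A r c + E r c" and "s \<equiv> AR m (mimage A bo bi) (fvec bo)"
  assumes exact: "mkernel A bo bi = mimage C bi bj"
    and E: "\<forall>r<bo. \<forall>c<bi. E r c \<in> ideal_pow m N" and sN: "s < N"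
    and init: "init_le m bo (mimage B bo bi) (mimage A bo bi)"
    and tN: "AR m (mimage C bi bj) (fvec bi) < N - s"
  obtains D where "\<forall>r<bi. \<forall>c<bj. D r c \<in> ideal_pow m (N - s)"
    "mkernel B bo bi = mimage (\<lambda>r c. C r c + D r c) bi bj"
    "init_le m bi (mimage C bi bj) (mimage (\<lambda>r c. C r c + D r c) bi bj)"
    "init_le m bi (mimage (\<lambda>r c. C r c + D r c) bi bj) (mimage C bi bj)"
proof -
  have "\<exists>w\<in>fpow m bi (N - s). mapply B bo bi w = mapply B bo bi (mcol C bi c)" if c: "c < bj" for c
  proof -
    have k: "mcol C bi c \<in> fvec bi" "mapply A bo bi (mcol C bi c) = 0"
      using mcol_in_mimage[OF c, of C bi] by (simp_all add: exact[symmetric] mkernel_iff)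
    have "mapply B bo bi (mcol C bi c) = mapply E bo bi (mcol C bi c)"
      unfolding B_def mapply_matrix_plus k(2) by simp
    moreover have "mapply E bo bi (mcol C bi c) \<in> fpow m bo (N + 0)"
      by (rule mapply_fpow[OF E]) (simp only: fpow_0 k(1))
    ultimately have "mapply B bo bi (mcol C bi c) \<in> fpow m bo N" by simp
    moreover have "mapply B bo bi (mcol C bi c) \<in> mimage B bo bi"
      using k(1) unfolding mimage_def by blast
    ultimately obtain u where
      "u \<in> fpow m bi (N - s)" "mapply B bo bi u = mapply B bo bi (mcol C bi c)"
      using perturb_lift[OF E sN[unfolded s_def] init[unfolded B_def],
          of "mapply B bo bi (mcol C bi c)" N, folded B_def s_def] sN
      by (metis (no_types, lifting) less_imp_le)
    then show ?thesis by blast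
  qed
  then obtain w where w: "\<And>c. c < bj \<Longrightarrow> w c \<in> fpow m bi (N - s)"
      "\<And>c. c < bj \<Longrightarrow> mapply B bo bi (w c) = mapply B bo bi (mcol C bi c)" by metis
  \<comment> \<open>With this sign the columns of C + D are those of \<open>C\<close> minus their
    corrections, which \<open>B\<close> kills.\<close>
  define D where "D r c = - w c r" for r c
  have D: "\<forall>r<bi. \<forall>c<bj. D r c \<in> ideal_pow m (N - s)"
    unfolding D_def using w(1)[unfolded fpow_iff] is_idealD(3)[OF is_ideal_ideal_pow] by blast
  have sub: "mimage (\<lambda>r c. C r c + D r c) bi bj \<subseteq> mkernel B bo bi"
  proof (rule mimage_subset[OF is_submod_mkernel])
    fix c assume c: "c < bj"
    have wf: "w c \<in> fvec bi" using w(1)[OF c] fpow_subset_fvec by blast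
    then have eq: "mcol (\<lambda>r c. C r c + D r c) bi c = mcol C bi c - w c"
      by (auto simp: mcol_def D_def fun_eq_iff fvec_def)
    have "mcol C bi c \<in> fvec bi" by (auto simp: mcol_def fvec_def)
    then show "mcol (\<lambda>r c. C r c + D r c) bi c \<in> mkernel B bo bi"
      unfolding eq mkernel_iff using wf w(2)[OF c] is_submodD(4)[OF is_submod_fvec]
      by (simp add: mapply_diff)
  qed
  have ker: "init_le m bi (mkernel B bo bi) (mimage C bi bj)"
    unfolding exact[symmetric] B_def
    by (rule perturb_kernel[OF E]) (use sN in \<open>simp_all add: s_def\<close>)
  note res = perturb_image[OF D tN is_submod_mkernel mkernel_subset_fvec sub ker]
  show ?thesis
    by (rule that[OF D res(1)[symmetric]]) (use res ker in simp_all)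
qed

end

section \<open>The Hilbert function controls the initial ideal\<close>

lemma is_ideal_ideal_sum:
  assumes I: "is_ideal I" and J: "is_ideal J" shows "is_ideal (ideal_sum I J)"
proof (rule is_idealI)
  have "0 + 0 \<in> ideal_sum I J"
    using is_idealD(1)[OF I] is_idealD(1)[OF J] unfolding ideal_sum_def by blast
  then show "0 \<in> ideal_sum I J" by simp
  fix x assume "x \<in> ideal_sum I J"
  then obtain i j where x: "x = i + j" "i \<in> I" "j \<in> J" unfolding ideal_sum_def by blast
  show "x + y \<in> ideal_sum I J" if y: "y \<in> ideal_sum I J" for y
  proof -
    obtain i' j' where y: "y = i' + j'" "i' \<in> I" "j' \<in> J" using y unfolding ideal_sum_def by blast
    have "x + y = (i + i') + (j + j')" by (simp add: x y algebra_simps)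
    then show ?thesis
      using is_idealD(2)[OF I x(2) y(2)] is_idealD(2)[OF J x(3) y(3)] unfolding ideal_sum_def by blast
  qed
  show "r * x \<in> ideal_sum I J" for r
    using is_idealD(5)[OF I x(2)] is_idealD(5)[OF J x(3)]
    unfolding ideal_sum_def x(1) distrib_left by blast
qed

lemma ideal_sum_memI: "x \<in> I \<Longrightarrow> y \<in> J \<Longrightarrow> x + y \<in> ideal_sum I J"
  unfolding ideal_sum_def by blast

lemma ideal_sum_superset:
  assumes "is_ideal I" "is_ideal J"
  shows "I \<subseteq> ideal_sum I J" "J \<subseteq> ideal_sum I J"
  using ideal_sum_memI[of _ I 0 J] ideal_sum_memI[of 0 I _ J] is_idealD(1)[OF assms(1)]
    is_idealD(1)[OF assms(2)] by auto

lemma ideal_gen_finite: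
  assumes "finite S" "g \<in> ideal_gen S"
  obtains r where "g = (\<Sum>x\<in>S. r x * x)"
proof -
  let ?T = "{g. \<exists>r. g = (\<Sum>x\<in>S. r x * x)}"
  have "is_ideal ?T"
  proof (rule is_idealI)
    have "0 = (\<Sum>x\<in>S. 0 * x)" by simp
    then show "0 \<in> ?T" by (intro CollectI exI)
    fix x assume "x \<in> ?T"
    then obtain r where r: "x = (\<Sum>x\<in>S. r x * x)" by blast
    show "x + y \<in> ?T" if y: "y \<in> ?T" for y
    proof -
      obtain q where q: "y = (\<Sum>x\<in>S. q x * x)" using y by blast
      have "x + y = (\<Sum>x\<in>S. (r x + q x) * x)" by (simp add: r q distrib_right sum.distrib)
      then show ?thesis by (intro CollectI exI)
    qed
    fix q
    have "q * x = (\<Sum>x\<in>S. (q * r x) * x)" by (simp add: r sum_distrib_left mult.assoc)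
    then show "q * x \<in> ?T" by (intro CollectI exI)
  qed
  moreover have "S \<subseteq> ?T"
  proof
    fix x assume "x \<in> S"
    then have "x = (\<Sum>z\<in>S. (if z = x then 1 else 0) * z)"
      using assms(1) by (simp add: if_distrib[of "\<lambda>y. y * _"] cong: if_cong)
    then show "x \<in> ?T" by (intro CollectI exI)
  qed
  ultimately have "g \<in> ?T" using ideal_gen_subset assms(2) by blast
  then show ?thesis using that by blast
qed

text \<open>Exchange argument: an element of \<open>J\<close> of order \<open>n\<close> whose initial form is not an initial form
  of \<open>I\<close> can replace one element of a minimal spanning set of \<open>m\<^sup>n(R/I)/m\<^sup>n\<^sup>+\<^sup>1(R/I)\<close>, so the
  remaining elements already span \<open>m\<^sup>n(R/J)/m\<^sup>n\<^sup>+\<^sup>1(R/J)\<close>.\<close>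

lemma (in noetherian_local) initial_ideal_eq_if_hilbert_fun_eq:
  assumes I: "is_ideal I" and J: "is_ideal J"
    and le: "\<And>x. x \<in> I \<Longrightarrow> x \<in> ideal_pow m n \<Longrightarrow> \<exists>x'\<in>J. x - x' \<in> ideal_pow m (Suc n)"
    and hilb: "hilbert_fun m I n = hilbert_fun m J n"
    and y: "y \<in> J" "y \<in> ideal_pow m n"
  shows "\<exists>y'\<in>I. y - y' \<in> ideal_pow m (Suc n)"
proof (rule ccontr)
  assume contra: "\<not> (\<exists>y'\<in>I. y - y' \<in> ideal_pow m (Suc n))"
  let ?p = "ideal_pow m n" and ?q = "ideal_pow m (Suc n)"
  have p: "is_ideal ?p" and q: "is_ideal ?q" by (rule is_ideal_ideal_pow)+
  have qp: "?q \<subseteq> ?p" by (rule ideal_pow_antimono) simp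
  let ?H = "\<lambda>I t. \<exists>S. finite S \<and> card S = t \<and> S \<subseteq> ideal_sum ?p I \<and>
       ideal_sum ?p I \<subseteq> ideal_sum (ideal_gen S) (ideal_sum ?q I)"
  \<comment> \<open>Generators of m^n form a spanning set, so the \<open>LEAST\<close> in the
    Hilbert function is attained.\<close>
  have "\<exists>t. ?H I t"
  proof -
    obtain S where S: "finite S" "?p = ideal_gen S"
      using noeth p unfolding noetherian_ring_def by blast
    have "S \<subseteq> ideal_sum ?p I"
      using S(2) ideal_gen_superset[of S] ideal_sum_superset(1)[OF p I] by blast
    moreover have "ideal_sum ?p I \<subseteq> ideal_sum (ideal_gen S) (ideal_sum ?q I)"
      using ideal_sum_superset(2)[OF q I] S(2) unfolding ideal_sum_def[of _ I]
      by (auto intro: ideal_sum_memI)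
    ultimately show ?thesis using S(1) by blast
  qed
  then have "?H I (hilbert_fun m I n)" unfolding hilbert_fun_def by (rule LeastI_ex)
  then obtain S where S: "finite S" "card S = hilbert_fun m I n" "S \<subseteq> ideal_sum ?p I"
      "ideal_sum ?p I \<subseteq> ideal_sum (ideal_gen S) (ideal_sum ?q I)" by blast
  \<comment> \<open>The spanning elements are changed modulo \<open>I\<close> so as to lie in m^n;
    their number does not grow.\<close>
  have "\<exists>z\<in>?p. x - z \<in> I" if x: "x \<in> S" for x
  proof -
    obtain z i where "x = z + i" "z \<in> ?p" "i \<in> I" using S(3) x unfolding ideal_sum_def by blast
    then show ?thesis by (intro bexI[of _ z]) simp_all
  qed
  then obtain f where f: "\<And>x. x \<in> S \<Longrightarrow> f x \<in> ?p" "\<And>x. x \<in> S \<Longrightarrow> x - f x \<in> I" by metis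
  define T where "T = f ` S"
  have T: "finite T" "card T \<le> hilbert_fun m I n" "T \<subseteq> ?p"
    using S(1,2) f(1) card_image_le[OF S(1), of f] by (auto simp: T_def)
  have genT: "is_ideal (ideal_gen T)" "ideal_gen T \<subseteq> ?p"
    using is_ideal_gen ideal_gen_subset[OF p T(3)] by auto
  have "S \<subseteq> ideal_sum (ideal_gen T) I"
  proof
    fix x assume x: "x \<in> S"
    have "f x \<in> ideal_gen T" using x ideal_gen_superset[of T] by (auto simp: T_def)
    from ideal_sum_memI[OF this f(2)[OF x]] show "x \<in> ideal_sum (ideal_gen T) I" by simp
  qed
  then have genS: "ideal_gen S \<subseteq> ideal_sum (ideal_gen T) I"
    by (rule ideal_gen_subset[OF is_ideal_ideal_sum[OF genT(1) I]])
  \<comment> \<open>The part \<open>i\<close> taken from \<open>I\<close> lies in m^n as well, as a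
    difference of elements of m^n; this allows \<open>le\<close> to be applied to it.\<close>
  have span: "\<exists>g\<in>ideal_gen T. \<exists>c\<in>?q. \<exists>i\<in>I. i \<in> ?p \<and> a = g + c + i" if a: "a \<in> ?p" for a
  proof -
    have "a \<in> ideal_sum (ideal_gen S) (ideal_sum ?q I)"
      using a S(4) ideal_sum_superset(1)[OF p I] by blast
    then obtain h c i where h: "a = h + (c + i)" "h \<in> ideal_gen S" "c \<in> ?q" "i \<in> I"
      unfolding ideal_sum_def by blast
    then obtain g i' where g: "h = g + i'" "g \<in> ideal_gen T" "i' \<in> I"
      using genS unfolding ideal_sum_def by blast
    have "i + i' = a - g - c" by (simp add: h g)
    moreover have "a - g - c \<in> ?p"
      using is_idealD(4)[OF p] a g(2) genT(2) h(3) qp by blast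
    ultimately have "i + i' \<in> ?p" by simp
    moreover have "a = g + c + (i + i')" by (simp add: h g)
    ultimately show ?thesis using g(2) h(3) is_idealD(2)[OF I h(4) g(3)] by blast
  qed
  obtain g c i where gci: "g \<in> ideal_gen T" "c \<in> ?q" "i \<in> I" "i \<in> ?p" "y = g + c + i"
    using span[OF y(2)] by blast
  obtain r where r: "g = (\<Sum>x\<in>T. r x * x)" using ideal_gen_finite[OF T(1) gci(1)] .
  \<comment> \<open>With all coefficients in \<open>m\<close>, the sum \<open>g\<close> would lie in
    m^(n+1), and \<open>y\<close> would be congruent to the element \<open>i\<close> of
    \<open>I\<close>.\<close>
  have "\<exists>x0\<in>T. r x0 \<notin> m"
  proof (rule ccontr)
    assume "\<not> (\<exists>x0\<in>T. r x0 \<notin> m)"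
    then have "r x * x \<in> ?q" if "x \<in> T" for x
      using that T(3) ideal_pow_mult[OF ideal_pow_1[of "r x" m], of x n] by auto
    then have "g \<in> ?q" unfolding r by (rule is_ideal_sum[OF q])
    then have "y - i \<in> ?q" using is_idealD(2)[OF q _ gci(2)] gci(5) by simp
    then show False using contra gci(3) by blast
  qed
  then obtain x0 where x0: "x0 \<in> T" "r x0 \<notin> m" by blast
  obtain w where w: "w * r x0 = 1" using local_ring_unit[OF loc x0(2)] .
  define T' where "T' = T - {x0}"
  let ?U = "ideal_sum (ideal_gen T') (ideal_sum ?q J)"
  have qJ: "is_ideal (ideal_sum ?q J)" by (rule is_ideal_ideal_sum[OF q J])
  have U: "is_ideal ?U" by (rule is_ideal_ideal_sum[OF is_ideal_gen qJ])
  have U_sup: "ideal_gen T' \<subseteq> ?U" "?q \<subseteq> ?U" "J \<subseteq> ?U"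
    using ideal_sum_superset[OF is_ideal_gen qJ, of T'] ideal_sum_superset[OF q J] by blast+
  have I_U: "i \<in> ?U" if i: "i \<in> I" "i \<in> ?p" for i
  proof -
    obtain j where j: "j \<in> J" "i - j \<in> ?q" using le[OF i] by blast
    then have "(i - j) + j \<in> ?U" using is_idealD(2)[OF U] U_sup by blast
    then show ?thesis by simp
  qed
  have T'_U: "T' \<subseteq> ?U" using U_sup(1) ideal_gen_superset[of T'] by blast
  \<comment> \<open>The relation y = g + c + i is solved for \<open>x0\<close>, whose coefficient is
    a unit; \<open>y\<close>, \<open>c\<close> and, through \<open>le\<close>, also \<open>i\<close>
    lie in \<open>?U\<close>.\<close>
  have "x0 \<in> ?U"
  proof -
    have "(\<Sum>x\<in>T'. r x * x) \<in> ?U"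
      by (rule is_ideal_sum[OF U]) (use T'_U is_idealD(5)[OF U] in blast)
    moreover have "y - c - i \<in> ?U"
      using is_idealD(4)[OF U] U_sup y(1) gci(2) I_U[OF gci(3,4)] by blast
    moreover have "r x0 * x0 = (y - c - i) - (\<Sum>x\<in>T'. r x * x)"
      using T(1) x0(1) by (simp add: gci(5) r T'_def sum.remove)
    ultimately have "r x0 * x0 \<in> ?U" using is_idealD(4)[OF U] by simp
    then have "w * (r x0 * x0) \<in> ?U" by (rule is_idealD(5)[OF U])
    then show ?thesis by (simp add: mult.assoc[symmetric] w)
  qed
  then have "T \<subseteq> ?U" using T'_U unfolding T'_def by blast
  then have gen_U: "ideal_gen T \<subseteq> ?U" by (rule ideal_gen_subset[OF U])
  have "?p \<subseteq> ?U"
  proof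
    fix a assume "a \<in> ?p"
    then obtain g c i where "g \<in> ideal_gen T" "c \<in> ?q" "i \<in> I" "i \<in> ?p" "a = g + c + i"
      using span by blast
    then show "a \<in> ?U" using gen_U U_sup(2) I_U is_idealD(2)[OF U] by blast
  qed
  then have "ideal_sum ?p J \<subseteq> ?U"
    using U_sup(3) is_idealD(2)[OF U] unfolding ideal_sum_def[of ?p J] by blast
  moreover have "T' \<subseteq> ideal_sum ?p J"
    using T(3) ideal_sum_superset(1)[OF p J] unfolding T'_def by blast
  ultimately have "?H J (card T')" using T(1) unfolding T'_def by blast
  then have "hilbert_fun m J n \<le> card T'" unfolding hilbert_fun_def by (rule Least_le)
  also have "\<dots> < card T" using T(1) x0(1) unfolding T'_def by (rule card_Diff1_less)
  finally show False using T(2) hilb by simp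
qed

section \<open>Ideals as submodules of the free module of rank one\<close>

lemma is_submod_ideal_vec: "is_ideal I \<Longrightarrow> is_submod (ideal_vec I)"
  by (auto simp: is_ideal_def is_submod_def ideal_vec_def)

lemma ideal_vec_subset_fvec: "ideal_vec I \<subseteq> fvec 1"
  by (auto simp: ideal_vec_def fvec_def)

lemma fpow_1_iff: "v \<in> fpow m 1 n \<longleftrightarrow> v 0 \<in> ideal_pow m n \<and> (\<forall>j\<ge>1. v j = 0)"
proof -
  have "(\<forall>j. v j \<in> ideal_pow m n) \<longleftrightarrow> v 0 \<in> ideal_pow m n" if "\<forall>j\<ge>1. v j = 0"
    using that is_idealD(1)[OF is_ideal_ideal_pow, of m n] by (metis less_one not_less)
  then show ?thesis unfolding fpow_iff by (auto simp: fvec_def)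
qed

text \<open>In degrees below \<open>N\<close> the congruence of \<open>I\<close> and
  \<open>J\<close> modulo m^N suffices. From \<open>N\<close> on, an element of \<open>I\<close> of
  order n is a combination of elements of order s < N with coefficients in m^(n-s), where s is the
  Artin--Rees number of \<open>I\<close>; approximants in \<open>J\<close> are multiplied by the
  same coefficients.\<close>

lemma (in noetherian_local) init_le_ideal_vec:
  assumes I: "is_ideal I" and J: "is_ideal J"
    and IJ: "ideal_sum J (ideal_pow m N) = ideal_sum I (ideal_pow m N)"
    and N: "AR m (ideal_vec I) (fvec 1) < N"
  shows "init_le m 1 (ideal_vec I) (ideal_vec J)"
proof (rule init_leI)
  let ?s = "AR m (ideal_vec I) (fvec 1)"
  have small: "\<exists>y'\<in>ideal_vec J. y - y' \<in> fpow m 1 (Suc n)" if "n < N" "y \<in> ideal_vec I" for n y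
  proof -
    have "y 0 \<in> ideal_sum J (ideal_pow m N)"
      unfolding IJ using that(2) ideal_sum_superset(1)[OF I is_ideal_ideal_pow]
      by (auto simp: ideal_vec_def)
    then obtain j z where j: "y 0 = j + z" "j \<in> J" "z \<in> ideal_pow m N"
      unfolding ideal_sum_def by blast
    have "z \<in> ideal_pow m (Suc n)" using j(3) ideal_pow_antimono[of "Suc n" N m] that(1) by auto
    then have "y - (\<lambda>k. if k = 0 then j else 0) \<in> fpow m 1 (Suc n)"
      using that(2) j(1) by (simp add: fpow_1_iff ideal_vec_def del: ideal_pow.simps One_nat_def)
    moreover have "(\<lambda>k. if k = 0 then j else 0) \<in> ideal_vec J"
      using j(2) by (simp add: ideal_vec_def)
    ultimately show ?thesis by blast
  qed
  fix n y assume y: "y \<in> ideal_vec I" "y \<in> fpow m 1 n"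
  show "\<exists>y'\<in>ideal_vec J. y - y' \<in> fpow m 1 (Suc n)"
  proof (cases "n < N")
    case True
    then show ?thesis using small y(1) by blast
  next
    case False
    let ?T = "{y. \<exists>y'\<in>ideal_vec J. y - y' \<in> fpow m 1 (Suc n)}"
    note JD = is_submodD[OF is_submod_ideal_vec[OF J]] and FD = is_submodD[OF is_submod_ideal_smult]
    have T: "is_submod ?T"
    proof (rule is_submodI)
      have "0 - 0 \<in> fpow m 1 (Suc n)" using FD(1) by simp
      then show "0 \<in> ?T" using JD(1) by blast
      fix u assume "u \<in> ?T"
      then obtain u' where u: "u' \<in> ideal_vec J" "u - u' \<in> fpow m 1 (Suc n)" by blast
      show "u + v \<in> ?T" if v: "v \<in> ?T" for v
      proof -
        obtain v' where v: "v' \<in> ideal_vec J" "v - v' \<in> fpow m 1 (Suc n)" using v by blast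
        have "(u + v) - (u' + v') = (u - u') + (v - v')" by simp
        then have "(u + v) - (u' + v') \<in> fpow m 1 (Suc n)" using FD(2)[OF u(2) v(2)] by metis
        then show ?thesis using JD(2)[OF u(1) v(1)] by blast
      qed
      fix r
      have "scl r u - scl r u' = scl r (u - u')" by (auto simp: right_diff_distrib)
      then have "scl r u - scl r u' \<in> fpow m 1 (Suc n)" using FD(5)[OF u(2)] by metis
      then show "scl r u \<in> ?T" using JD(5)[OF u(1)] by blast
    qed
    have "ideal_smult (ideal_pow m (n - ?s)) (fpow m 1 ?s \<inter> ideal_vec I) \<subseteq> ?T"
    proof (rule ideal_smult_subset[OF T])
      fix a v assume a: "a \<in> ideal_pow m (n - ?s)" and "v \<in> fpow m 1 ?s \<inter> ideal_vec I"
      then obtain v' where v': "v' \<in> ideal_vec J" "v - v' \<in> fpow m 1 (Suc ?s)"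
        using small[OF N] by blast
      have "scl a v - scl a v' = scl a (v - v')" by (auto simp: right_diff_distrib)
      moreover have "scl a (v - v') \<in> fpow m 1 (n - ?s + Suc ?s)" using scl_fpow[OF a v'(2)] .
      moreover have "n - ?s + Suc ?s = Suc n" using False N by simp
      ultimately have "scl a v - scl a v' \<in> fpow m 1 (Suc n)" by metis
      then show "scl a v \<in> ?T" using JD(5)[OF v'(1)] by blast
    qed
    then show ?thesis
      using AR_property[OF is_submod_ideal_vec[OF I], of 1 n] False N y by auto
  qed
qed

text \<open>Degree by degree, \<open>init_le_ideal_vec\<close> gives one inclusion and the equality
  of Hilbert functions reverses it; the map \<open>e\<close> passes from ring elements to vectors of
  length one.\<close>

lemma (in noetherian_local) init_le_ideal_vec_if_hilbert_fun_eq: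
  assumes I: "is_ideal I" and J: "is_ideal J"
    and IJ: "ideal_sum J (ideal_pow m N) = ideal_sum I (ideal_pow m N)"
    and N: "AR m (ideal_vec I) (fvec 1) < N" and hilb: "hilbert_fun m I = hilbert_fun m J"
  shows "init_le m 1 (ideal_vec J) (ideal_vec I)"
proof (rule init_leI)
  fix n y assume y: "y \<in> ideal_vec J" "y \<in> fpow m 1 n"
  define e where "e x = (\<lambda>k::nat. if k = 0 then x else 0)" for x :: 'a
  have "\<exists>x'\<in>J. x - x' \<in> ideal_pow m (Suc n)" if "x \<in> I" "x \<in> ideal_pow m n" for x
  proof -
    have "e x \<in> ideal_vec I" "e x \<in> fpow m 1 n"
      using that by (simp_all add: e_def ideal_vec_def fpow_1_iff del: One_nat_def)
    then obtain y' where "y' \<in> ideal_vec J" "e x - y' \<in> fpow m 1 (Suc n)"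
      using init_leD[OF init_le_ideal_vec[OF I J IJ N]] by blast
    then have "y' 0 \<in> J" "x - y' 0 \<in> ideal_pow m (Suc n)"
      by (simp_all add: ideal_vec_def fpow_1_iff e_def del: ideal_pow.simps One_nat_def)
    then show ?thesis by blast
  qed
  moreover have "y 0 \<in> J" "y 0 \<in> ideal_pow m n" using y by (simp_all add: ideal_vec_def fpow_1_iff del: One_nat_def)
  ultimately obtain x where x: "x \<in> I" "y 0 - x \<in> ideal_pow m (Suc n)"
    using initial_ideal_eq_if_hilbert_fun_eq[OF I J _ fun_cong[OF hilb]] by blast
  have "e x \<in> ideal_vec I" using x(1) by (simp add: e_def ideal_vec_def)
  moreover have "y - e x \<in> fpow m 1 (Suc n)"
    using x(2) y(1) by (simp add: fpow_1_iff e_def ideal_vec_def del: ideal_pow.simps One_nat_def)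
  ultimately show "\<exists>y'\<in>ideal_vec I. y - y' \<in> fpow m 1 (Suc n)" by blast
qed

text \<open>The start of the recursion. Each generator of \<open>I\<close> becomes an element of
  \<open>J\<close> after subtraction of some \<open>h c\<close> in m^N. Equality of the Hilbert
  functions supplies the comparison of initial modules that \<open>perturb_image\<close> asks for,
  so the modified generators generate \<open>J\<close>.\<close>

lemma (in noetherian_local) perturb_ideal_generators:
  assumes I: "is_ideal I" and J: "is_ideal J"
    and IJ: "ideal_sum J (ideal_pow m N) = ideal_sum I (ideal_pow m N)"
    and A: "mimage A 1 bi = ideal_vec I"
    and N: "AR m (ideal_vec I) (fvec 1) < N" and hilb: "hilbert_fun m I = hilbert_fun m J"
  obtains E where "\<forall>r<1. \<forall>c<bi. E r c \<in> ideal_pow m N"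
    "mimage (\<lambda>r c. A r c + E r c) 1 bi = ideal_vec J"
    "init_le m 1 (mimage A 1 bi) (mimage (\<lambda>r c. A r c + E r c) 1 bi)"
    "init_le m 1 (mimage (\<lambda>r c. A r c + E r c) 1 bi) (mimage A 1 bi)"
proof -
  have "\<exists>h\<in>ideal_pow m N. A 0 c - h \<in> J" if c: "c < bi" for c
  proof -
    have "A 0 c \<in> I" using mcol_in_mimage[OF c, of A 1] by (simp add: A ideal_vec_def mcol_def del: One_nat_def)
    then have "A 0 c \<in> ideal_sum J (ideal_pow m N)"
      unfolding IJ using ideal_sum_superset(1)[OF I is_ideal_ideal_pow] by blast
    then obtain j h where "A 0 c = j + h" "j \<in> J" "h \<in> ideal_pow m N"
      unfolding ideal_sum_def by blast
    then show ?thesis by (intro bexI[of _ h]) simp_all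
  qed
  then obtain h where h: "\<And>c. c < bi \<Longrightarrow> h c \<in> ideal_pow m N" "\<And>c. c < bi \<Longrightarrow> A 0 c - h c \<in> J"
    by metis
  define E :: "nat \<Rightarrow> nat \<Rightarrow> 'a" where "E r c = - h c" for r c
  have E: "\<forall>r<1. \<forall>c<bi. E r c \<in> ideal_pow m N"
    unfolding E_def using h(1) is_idealD(3)[OF is_ideal_ideal_pow] by blast
  have sub: "mimage (\<lambda>r c. A r c + E r c) 1 bi \<subseteq> ideal_vec J"
    by (rule mimage_subset[OF is_submod_ideal_vec[OF J]])
      (use h(2) in \<open>simp add: mcol_def ideal_vec_def E_def\<close>)
  have init: "init_le m 1 (ideal_vec J) (mimage A 1 bi)"
    unfolding A by (rule init_le_ideal_vec_if_hilbert_fun_eq[OF I J IJ N hilb])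
  note res = perturb_image[OF E N[folded A] is_submod_ideal_vec[OF J] ideal_vec_subset_fvec sub init]
  show ?thesis by (rule that[OF E res(1)]) (use res init in simp_all)
qed

section \<open>Perturbing the resolution\<close>

theorem theorem3p6:
  fixes m I :: "'a::comm_ring_1 set"
    and b :: "nat \<Rightarrow> nat"
    and d :: "nat \<Rightarrow> nat \<Rightarrow> nat \<Rightarrow> 'a"
    and s :: "nat \<Rightarrow> nat"
    and p N0 N :: nat
  assumes noeth: "noetherian_ring TYPE('a)"
    and loc: "local_ring m"
    and I: "is_ideal I"
    and F0: "b 0 = 1"
    and res0: "mimage (d 1) (b 0) (b 1) = ideal_vec I"
    and resex: "\<forall>i\<ge>1. mkernel (d i) (b (i - 1)) (b i) = mimage (d (Suc i)) (b i) (b (Suc i))"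
    and minimal: "\<forall>i\<ge>1. \<forall>r<b (i - 1). \<forall>c<b i. d i r c \<in> m"
    and s_def: "\<forall>n. s n = AR m (mimage (d (Suc n)) (b n) (b (Suc n))) (fvec (b n))"
    and N0: "\<forall>i\<le>p. s i < N0"
    and N: "N > N0 + (\<Sum>i<p. s i)"
  shows "\<forall>J. is_ideal J \<and> ideal_sum J (ideal_pow m N) = ideal_sum I (ideal_pow m N)
             \<and> hilbert_fun m I = hilbert_fun m J \<longrightarrow>
          (\<exists>\<delta> :: nat \<Rightarrow> nat \<Rightarrow> nat \<Rightarrow> 'a.
             (\<forall>i\<in>{1..Suc p}. mimage (\<delta> i) (b (i - 1)) (b i)
                  \<subseteq> ideal_smult (ideal_pow m N0) (fvec (b (i - 1))))
           \<and> mimage (\<lambda>r c. d 1 r c + \<delta> 1 r c) (b 0) (b 1) = ideal_vec J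
           \<and> (\<forall>i\<in>{1..p}. mkernel (\<lambda>r c. d i r c + \<delta> i r c) (b (i - 1)) (b i)
                  = mimage (\<lambda>r c. d (Suc i) r c + \<delta> (Suc i) r c) (b i) (b (Suc i)))
           \<and> (\<forall>i\<in>{1..Suc p}.
                initial_module m (fvec (b (i - 1))) (mimage (d i) (b (i - 1)) (b i))
              = initial_module m (fvec (b (i - 1)))
                  (mimage (\<lambda>r c. d i r c + \<delta> i r c) (b (i - 1)) (b i))))"
proof (intro allI impI, elim conjE)
  fix J assume J: "is_ideal J" and IJ: "ideal_sum J (ideal_pow m N) = ideal_sum I (ideal_pow m N)"
    and hilb: "hilbert_fun m I = hilbert_fun m J"
  interpret noetherian_local m using noeth loc by unfold_locales
  \<comment> \<open>\<open>M n\<close> is the order guaranteed for the perturbation of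
    \<open>d (Suc n)\<close>: step \<open>i\<close> costs \<open>s i\<close>, and the bound on
    \<open>N\<close> keeps \<open>M n\<close> above \<open>N0\<close> for
    \<open>n \<le> p\<close>.\<close>
  define M where "M n = N - (\<Sum>i<n. s i)" for n
  define im where "im n = mimage (d (Suc n)) (b n) (b (Suc n))" for n
  define im' where "im' n E = mimage (\<lambda>r c. d (Suc n) r c + E r c) (b n) (b (Suc n))" for n E
  define ker' where "ker' n E = mkernel (\<lambda>r c. d (Suc n) r c + E r c) (b n) (b (Suc n))" for n E
  have s: "AR m (im n) (fvec (b n)) = s n" for n using s_def by (simp add: im_def)
  have M: "N0 < M n" if "n \<le> p" for n
  proof -
    have "(\<Sum>i<n. s i) \<le> (\<Sum>i<p. s i)" by (rule sum_mono2) (use that in auto)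
    then show ?thesis using N by (simp add: M_def)
  qed
  have M_Suc: "M (Suc n) = M n - s n" for n by (simp add: M_def)
  have sM: "s n < M n" if "n \<le> p" for n using M[OF that] N0 that by (meson less_trans)
  \<comment> \<open>The guards \<open>n \<le> p\<close> and \<open>n < p\<close> let the sequence
    continue with arbitrary matrices after index \<open>p\<close>. The clause for
    \<open>n = 0\<close> puts the starting condition into the invariant, through which dependent
    choice preserves it.\<close>
  let ?P = "\<lambda>n E. n \<le> p \<longrightarrow> (\<forall>r<b n. \<forall>c<b (Suc n). E r c \<in> ideal_pow m (M n)) \<and>
    init_le m (b n) (im n) (im' n E) \<and> init_le m (b n) (im' n E) (im n) \<and>
    (n = 0 \<longrightarrow> im' n E = ideal_vec J)"
  let ?Q = "\<lambda>n E D. n < p \<longrightarrow> ker' n E = im' (Suc n) D"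
  have "\<exists>f. \<forall>n. ?P n (f n) \<and> ?Q n (f n) (f (Suc n))"
  proof (rule dependent_nat_choice)
    have I0: "mimage (d (Suc 0)) 1 (b (Suc 0)) = ideal_vec I" using res0 F0 by simp
    have "AR m (ideal_vec I) (fvec 1) < N"
      using s[of 0] sM[of 0] I0 F0 by (simp add: im_def M_def)
    from perturb_ideal_generators[OF I J IJ I0 this hilb] obtain E where
      "\<forall>r<1. \<forall>c<b (Suc 0). E r c \<in> ideal_pow m N"
      "im' 0 E = ideal_vec J" "init_le m 1 (im 0) (im' 0 E)" "init_le m 1 (im' 0 E) (im 0)"
      unfolding im_def im'_def F0 by blast
    then have "?P 0 E" by (simp add: F0 M_def)
    then show "\<exists>E. ?P 0 E" by blast
  next
    fix E n assume P: "?P n E"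
    show "\<exists>D. ?P (Suc n) D \<and> ?Q n E D"
    proof (cases "n < p")
      case False
      then show ?thesis by simp
    next
      case True
      then have n: "n \<le> p" "Suc n \<le> p" by simp_all
      have exact: "mkernel (d (Suc n)) (b n) (b (Suc n)) = im (Suc n)"
        using resex[rule_format, of "Suc n"] by (simp add: im_def)
      have E: "\<forall>r<b n. \<forall>c<b (Suc n). E r c \<in> ideal_pow m (M n)"
        and init: "init_le m (b n) (im' n E) (im n)" using P n by blast+
      obtain D where
        "\<forall>r<b (Suc n). \<forall>c<b (Suc (Suc n)). D r c \<in> ideal_pow m (M n - s n)"
        "ker' n E = im' (Suc n) D" "init_le m (b (Suc n)) (im (Suc n)) (im' (Suc n) D)"
        "init_le m (b (Suc n)) (im' (Suc n) D) (im (Suc n))"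
        using perturb_step[OF exact[unfolded im_def] E, folded im_def im'_def ker'_def, unfolded s]
          sM[OF n(1)] init sM[OF n(2)] unfolding M_Suc by blast
      then show ?thesis unfolding M_Suc by blast
    qed
  qed
  then obtain f where f: "\<forall>n. ?P n (f n) \<and> ?Q n (f n) (f (Suc n))" by (rule exE)
  note P = conjunct1[OF spec[OF f]] and Q = conjunct2[OF spec[OF f]]
  \<comment> \<open>Indices shift by one: \<open>f n\<close> perturbs \<open>d (Suc n)\<close>,
    whereas \<open>\<delta> i\<close> perturbs \<open>d i\<close>.\<close>
  define \<delta> where "\<delta> i = f (i - 1)" for i
  have small: "mimage (f n) (b n) (b (Suc n)) \<subseteq> fpow m (b n) N0" if "n \<le> p" for n
  proof -
    have "\<forall>r<b n. \<forall>c<b (Suc n). f n r c \<in> ideal_pow m N0"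
      using P[of n] that ideal_pow_antimono[of N0 "M n" m] M[OF that] by (meson less_imp_le subsetD)
    from mapply_fpow[OF this, of _ 0] show ?thesis
      unfolding mimage_def fpow_0 by auto
  qed
  show "\<exists>\<delta> :: nat \<Rightarrow> nat \<Rightarrow> nat \<Rightarrow> 'a.
             (\<forall>i\<in>{1..Suc p}. mimage (\<delta> i) (b (i - 1)) (b i)
                  \<subseteq> ideal_smult (ideal_pow m N0) (fvec (b (i - 1))))
           \<and> mimage (\<lambda>r c. d 1 r c + \<delta> 1 r c) (b 0) (b 1) = ideal_vec J
           \<and> (\<forall>i\<in>{1..p}. mkernel (\<lambda>r c. d i r c + \<delta> i r c) (b (i - 1)) (b i)
                  = mimage (\<lambda>r c. d (Suc i) r c + \<delta> (Suc i) r c) (b i) (b (Suc i)))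
           \<and> (\<forall>i\<in>{1..Suc p}.
                initial_module m (fvec (b (i - 1))) (mimage (d i) (b (i - 1)) (b i))
              = initial_module m (fvec (b (i - 1)))
                  (mimage (\<lambda>r c. d i r c + \<delta> i r c) (b (i - 1)) (b i)))"
  proof (intro exI[of _ \<delta>] conjI ballI)
    show "mimage (\<lambda>r c. d 1 r c + \<delta> 1 r c) (b 0) (b 1) = ideal_vec J"
      using P[of 0] by (simp add: \<delta>_def im'_def)
  next
    fix i assume "i \<in> {1..Suc p}"
    then obtain n where n: "i = Suc n" "n \<le> p" by (cases i) auto
    show "mimage (\<delta> i) (b (i - 1)) (b i) \<subseteq> ideal_smult (ideal_pow m N0) (fvec (b (i - 1)))"
      using small n by (simp add: \<delta>_def)
    show "initial_module m (fvec (b (i - 1))) (mimage (d i) (b (i - 1)) (b i))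
        = initial_module m (fvec (b (i - 1)))
            (mimage (\<lambda>r c. d i r c + \<delta> i r c) (b (i - 1)) (b i))"
      using init_le_antisym[of m "b n" "im n" "im' n (f n)"] P[of n] n
      by (simp add: \<delta>_def im_def im'_def)
  next
    fix i assume "i \<in> {1..p}"
    then obtain n where n: "i = Suc n" "n < p" by (cases i) auto
    then show "mkernel (\<lambda>r c. d i r c + \<delta> i r c) (b (i - 1)) (b i)
        = mimage (\<lambda>r c. d (Suc i) r c + \<delta> (Suc i) r c) (b i) (b (Suc i))"
      using Q[of n] by (simp add: \<delta>_def ker'_def im'_def)
  qed
qed

end
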